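(* Let $\overline{D}\subset\mathbb{C}$ be a closed disc with centre at $0$, let $m\geq 1$ be an integer, and let $F(z)=\overline{z}^{\,m}+R(z)$ for $z\in\overline{D}$, where $R:\overline{D}\to\mathbb{C}$ satisfies $$|R(z)-R(\zeta)|\ <\ |z^m-\zeta^m|\quad\text{for all } z,\zeta\in\overline{D}\text{ with } z^m\neq\zeta^m.$$ Then the graph $\Gamma_{\overline{D}}(F)$ is polynomially convex. Additionally, $[z,F]_{\overline{D}}=\mathcal{C}(\overline{D})$ in each of the following cases: - $m=1$ (with no further conditions on $R$); - $m\geq 2$, $R\in\mathcal{C}^1(\overline{D})$, and there exists $\alpha\in(0,1)$ such that $R$ satisfies the stronger estimate $$|R(z)-R(\zeta)|\ <\ \alpha\,|z^m-\zeta^m|\quad\text{for all } z,\zeta\in\overline{D}\text{ with } z^m\neq\zeta^m.$$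
   Context: $\Gamma_{\overline{D}}(F):=\{(z,F(z)):z\in\overline{D}\}\subset\mathbb{C}^2$. A compact set $X\subset\mathbb{C}^n$ is polynomially convex if it equals its polynomially convex hull $\widehat{X}=\{x\in\mathbb{C}^n: |p(x)|\leq\sup_X|p| \text{ for every holomorphic polynomial } p\}$. $[z,F]_{\overline{D}}$ denotes the uniform algebra on $\overline{D}$ generated by $z$ and $F$, i.e. the closure in $\mathcal{C}(\overline{D})$ (complex-valued continuous functions, sup norm) of the polynomials in $z$ and $F$. $\mathcal{C}^1(\overline{D})$ denotes the complex-valued functions that are continuously differentiable (in the real sense) up to the boundary. *)

theory Defs
  imports "HOL-Analysis.Analysis"
begin

(* A multi-index is a function 'n => nat; the monomial with multi-index a is the product of
   the (x $ i) ^ a i. *)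
definition holomorphic_polynomial :: "(complex ^ 'n \<Rightarrow> complex) \<Rightarrow> bool" where
  "holomorphic_polynomial p \<longleftrightarrow>
     (\<exists>(A :: ('n \<Rightarrow> nat) set) c. finite A \<and>
        p = (\<lambda>x. \<Sum>a\<in>A. c a * (\<Prod>i\<in>UNIV. x $ i ^ a i)))"

(* The supremum is taken in the reals, so the hull is only meaningful for nonempty sets on
   which polynomials are bounded, in particular for nonempty compact sets. *)
definition polynomial_hull :: "(complex ^ 'n) set \<Rightarrow> (complex ^ 'n) set" where
  "polynomial_hull X =
     {x. \<forall>p. holomorphic_polynomial p \<longrightarrow> norm (p x) \<le> (SUP y\<in>X. norm (p y))}"

definition polynomially_convex :: "(complex ^ 'n) set \<Rightarrow> bool" where
  "polynomially_convex X \<longleftrightarrow> compact X \<and> X = polynomial_hull X"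

definition graph_over :: "complex set \<Rightarrow> (complex \<Rightarrow> complex) \<Rightarrow> (complex ^ 2) set" where
  "graph_over K F = {vector [z, F z] | z. z \<in> K}"

(* The metric space C(K) with the sup metric, for compact K. Its elements are extensional:
   they take the value undefined outside K, so functions on K are entered through restrict. *)
definition C_space :: "complex set \<Rightarrow> (complex \<Rightarrow> complex) metric" where
  "C_space K = cfunspace (top_of_set K) euclidean_metric"

(* [f, g]_K, for f and g continuous on the compact set K. *)
definition uniform_algebra ::
  "complex set \<Rightarrow> (complex \<Rightarrow> complex) \<Rightarrow> (complex \<Rightarrow> complex) \<Rightarrow> (complex \<Rightarrow> complex) set" where
  "uniform_algebra K f g =
     mtopology_of (C_space K) closure_of
       {restrict (\<lambda>z. p (vector [f z, g z] :: complex ^ 2)) K | p. holomorphic_polynomial p}"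

(* Real differentiability up to the boundary: one-sided derivatives relative to K, depending
   continuously on the point of K. For a closed disc K of positive radius this is the same as
   being real C^1 in the interior with f and its first partial derivatives extending
   continuously to K. *)
definition C1_up_to_boundary :: "complex set \<Rightarrow> (complex \<Rightarrow> complex) \<Rightarrow> bool" where
  "C1_up_to_boundary K f \<longleftrightarrow>
     (\<exists>f' :: complex \<Rightarrow> complex \<Rightarrow>\<^sub>L complex.
        continuous_on K f' \<and> (\<forall>z\<in>K. (f has_derivative blinfun_apply (f' z)) (at z within K)))"

end

(* Since R z = R zeta whenever z^m = zeta^m, one has F z = f (z^m) with f w = cnj w + S w and S
   strictly contractive, so Re ((w - zeta) (f w - f zeta)) > 0 for w, zeta distinct points of the
   disc of radius r^m. Hence (f w - f zeta) / ((w - zeta) (f w - f zeta) + e) is, as a function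
   of w, a uniform limit of polynomials in w and f w, and it tends to the Cauchy kernel
   1 / (w - zeta) as e tends to 0 (Wermer's trick), dominated by 1 / |w - zeta|. Integrating over
   zeta in the disc and using that the area integral of 1 / (w - zeta) is pi * cnj w, one
   approximates cnj w uniformly. With w = z^m this puts cnj z ^ m, then cnj z, and then by
   Stone-Weierstrass every continuous function, in [z, F].

   Density of the polynomials in C(K) gives polynomial convexity: if (a, b) is not on the graph,
   then 1 = (z - a) h1 + (F z - b) h2 on K with h1, h2 continuous, and replacing h1, h2 by
   polynomial approximations gives a polynomial 1 - (z - a) p1 - (w - b) p2 that is small on the
   graph and equals 1 at (a, b). *)
theory Submission
  imports Defs "HOL-Complex_Analysis.Cauchy_Integral_Formula"
begin

section \<open>Explicit circle means of the Cauchy kernel and of its squared modulus\<close>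

section \<open>Means over circles\<close>

text \<open>The angle is normalized to \<open>t\<close> in \<open>{0..1}\<close>, matching
  \<open>circlepath\<close>, so an integral over \<open>{0..1}\<close> is already the mean over the
  circle of radius \<open>s\<close>.\<close>

definition circle_point :: "real \<Rightarrow> real \<Rightarrow> complex" where
  "circle_point s t = of_real s * exp (2 * of_real pi * \<i> * of_real t)"

lemma norm_circle_point [simp]: "norm (circle_point s t) = \<bar>s\<bar>"
  by (simp add: circle_point_def norm_mult norm_exp_eq_Re)

lemma continuous_on_circle_point [continuous_intros]:
  assumes "continuous_on A f" "continuous_on A g"
  shows "continuous_on A (\<lambda>x. circle_point (f x) (g x))"
  unfolding circle_point_def by (intro continuous_intros assms)

text \<open>Cauchy's integral formula at the centre, where the factor 2 pi i cancels. The degenerate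
  circle \<open>s = 0\<close> is treated apart.\<close>

lemma mean_value_circle:
  assumes "f holomorphic_on ball 0 R" "0 \<le> s" "s < R"
  shows "((\<lambda>t. f (circle_point s t)) has_integral f 0) {0..1}"
proof (cases "s = 0")
  case True
  then show ?thesis
    using has_integral_const_real[of "f 0" 0 1] by (simp add: circle_point_def)
next
  case False
  then have s: "s > 0" using assms by simp
  have "f holomorphic_on cball 0 s"
    using assms by (auto intro: holomorphic_on_subset)
  from Cauchy_integral_circlepath_simple[OF this, of 0] s
  have "((\<lambda>u. f u / u) has_contour_integral 2 * of_real pi * \<i> * f 0) (circlepath 0 s)"
    by simp
  then have "((\<lambda>t. f (circlepath 0 s t) / circlepath 0 s t * vector_derivative (circlepath 0 s) (at t))
      has_integral 2 * of_real pi * \<i> * f 0) {0..1}"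
    by (simp add: has_contour_integral)
  then have "((\<lambda>t. (2 * of_real pi * \<i>) * f (circle_point s t)) has_integral 2 * of_real pi * \<i> * f 0) {0..1}"
  proof (rule has_integral_eq[rotated])
    fix t :: real
    have "circlepath 0 s t = circle_point s t"
      by (simp add: circlepath circle_point_def)
    moreover have "vector_derivative (circlepath 0 s) (at t) = 2 * of_real pi * \<i> * circle_point s t"
      by (simp add: vector_derivative_circlepath circle_point_def)
    moreover have "circle_point s t \<noteq> 0"
      using s by (simp add: circle_point_def)
    ultimately show "f (circlepath 0 s t) / circlepath 0 s t * vector_derivative (circlepath 0 s) (at t)
        = 2 * of_real pi * \<i> * f (circle_point s t)"
      by simp
  qed
  from has_integral_mult_right[OF this, of "1 / (2 * of_real pi * \<i>)"]
  show ?thesis by simp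
qed

lemma mean_value_circle_cnj:
  assumes "f holomorphic_on ball 0 R" "0 \<le> s" "s < R"
  shows "((\<lambda>t. cnj (f (circle_point s t))) has_integral cnj (f 0)) {0..1}"
  using mean_value_circle[OF assms] by (subst (asm) has_integral_cnj[symmetric]) (simp add: o_def)

lemma cnj_circle_point: "cnj (circle_point s t) * circle_point s t = of_real (s\<^sup>2)"
  by (metis complex_norm_square mult.commute norm_circle_point power2_abs)

text \<open>Inside radius |z| the kernel is holomorphic in w, and its value at 0 is 1 / z. For s >
  |z| the relation cnj w = s^2 / w on the circle turns the kernel into the conjugate of w / (cnj z *
  w - s^2), which is holomorphic on a slightly larger disc and vanishes at 0.\<close>

lemma circle_mean_cauchy_kernel:
  assumes "0 \<le> s" "s \<noteq> norm z"
  shows "((\<lambda>t. 1 / (z - circle_point s t)) has_integral (if s < norm z then 1 / z else 0)) {0..1}"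
proof (cases "s < norm z")
  case True
  have "(\<lambda>w. 1 / (z - w)) holomorphic_on ball 0 (norm z)"
    by (intro holomorphic_intros) auto
  from mean_value_circle[OF this \<open>0 \<le> s\<close> True] True show ?thesis by simp
next
  case False
  with assms have s: "s > norm z" by simp
  then have s0: "s > 0" using norm_ge_zero[of z] by linarith
  \<comment> \<open>The pole has modulus s^2 / |z|, so R must satisfy s < R and |z| R < s^2. For R =
    2 s - |z| the difference s^2 - |z| R is the square (s - |z|)^2.\<close>
  define R where "R = s + (s - norm z)"
  have "norm z * R < s * s"
  proof -
    have "s * s - norm z * R = (s - norm z)\<^sup>2"
      by (simp add: R_def power2_eq_square algebra_simps)
    moreover have "(s - norm z)\<^sup>2 > 0" using s by simp
    ultimately show ?thesis by linarith
  qed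
  have "of_real (s\<^sup>2) - cnj z * w \<noteq> 0" if "w \<in> ball 0 R" for w
  proof
    assume "of_real (s\<^sup>2) - cnj z * w = 0"
    then have "norm (cnj z * w) = s\<^sup>2"
      by (metis eq_iff_diff_eq_0 norm_of_real abs_power2)
    moreover have "norm (cnj z * w) \<le> norm z * R"
      using that by (simp add: norm_mult mult_left_mono)
    ultimately show False using \<open>norm z * R < s * s\<close> by (simp add: power2_eq_square)
  qed
  then have "(\<lambda>w. w / (cnj z * w - of_real (s\<^sup>2))) holomorphic_on ball 0 R"
    by (intro holomorphic_intros) (metis diff_eq_eq add_0 diff_self)
  from mean_value_circle_cnj[OF this \<open>0 \<le> s\<close>] s
  have "((\<lambda>t. cnj (circle_point s t / (cnj z * circle_point s t - of_real (s\<^sup>2)))) has_integral 0) {0..1}"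
    by (simp add: R_def)
  moreover have "cnj (circle_point s t / (cnj z * circle_point s t - of_real (s\<^sup>2))) = 1 / (z - circle_point s t)" for t
  proof -
    have "cnj (circle_point s t) \<noteq> 0"
      using s0 norm_circle_point[of s t] by fastforce
    moreover have "cnj (cnj z * circle_point s t - of_real (s\<^sup>2)) = cnj (circle_point s t) * (z - circle_point s t)"
      unfolding cnj_circle_point[symmetric, of s t] by (simp add: algebra_simps)
    ultimately show ?thesis
      by simp
  qed
  ultimately show ?thesis using False by simp
qed

text \<open>For |w| = s the real part of 2 z / (z - w) - 1 = (z + w) / (z - w) is the Poisson kernel
  (|z|^2 - s^2) / |z - w|^2. Its mean is therefore the real part of a mean already known, namely 1
  or -1 according to the sign of |z|^2 - s^2.\<close>

lemma circle_mean_square_kernel: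
  assumes "0 \<le> s" "s \<noteq> norm z"
  shows "((\<lambda>t. 1 / (norm (z - circle_point s t))\<^sup>2) has_integral 1 / \<bar>(norm z)\<^sup>2 - s\<^sup>2\<bar>) {0..1}"
proof -
  define d where "d = (norm z)\<^sup>2 - s\<^sup>2"
  have d: "d \<noteq> 0" using assms by (simp add: d_def power2_eq_iff_nonneg)
  have "((\<lambda>t. 2 * z * (1 / (z - circle_point s t)) - 1) has_integral
      2 * z * (if s < norm z then 1 / z else 0) - 1) {0..1}"
    using has_integral_const_real[of "1::complex" 0 1]
    by (intro has_integral_diff has_integral_mult_right circle_mean_cauchy_kernel assms) simp
  moreover have "2 * z * (if s < norm z then 1 / z else 0) - 1 = of_real (sgn d)"
  proof (cases "s < norm z")
    case True
    then have "d > 0" using assms by (simp add: d_def power_strict_mono)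
    with True assms show ?thesis by auto
  next
    case False
    then have "d < 0" using assms by (simp add: d_def power_strict_mono)
    with False show ?thesis by auto
  qed
  ultimately have "((\<lambda>t. 2 * z * (1 / (z - circle_point s t)) - 1) has_integral of_real (sgn d)) {0..1}"
    by simp
  from has_integral_linear[OF this bounded_linear_Re]
  have "((\<lambda>t. Re (2 * z * (1 / (z - circle_point s t)) - 1)) has_integral sgn d) {0..1}"
    by (simp only: o_def Re_complex_of_real)
  moreover have "Re (2 * z * (1 / (z - circle_point s t)) - 1) = d * (1 / (norm (z - circle_point s t))\<^sup>2)" for t
  proof -
    define w where "w = circle_point s t"
    have wz: "z \<noteq> w" and nw: "(norm w)\<^sup>2 = s\<^sup>2" using assms by (auto simp: w_def)
    have "2 * z * (1 / (z - w)) - 1 = (z + w) / (z - w)" using wz by (simp add: field_simps)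
    also have "\<dots> = (z + w) * cnj (z - w) / of_real ((norm (z - w))\<^sup>2)"
      by (rule complex_div_cnj[unfolded of_real_power[symmetric]])
    also have "Re \<dots> = Re ((z + w) * cnj (z - w)) / (norm (z - w))\<^sup>2"
      by (simp only: Re_divide_of_real)
    also have "Re ((z + w) * cnj (z - w)) = d"
      unfolding d_def nw[symmetric] cmod_power2 by (simp add: power2_eq_square algebra_simps)
    finally show ?thesis by (simp add: w_def)
  qed
  ultimately have "((\<lambda>t. d * (1 / (norm (z - circle_point s t))\<^sup>2)) has_integral sgn d) {0..1}"
    by simp
  from has_integral_mult_right[OF this, of "1 / d"] d
  have "((\<lambda>t. 1 / (norm (z - circle_point s t))\<^sup>2) has_integral 1 / d * sgn d) {0..1}"
    by simp
  moreover have "1 / d * sgn d = 1 / \<bar>d\<bar>"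
    by (simp add: sgn_if abs_if)
  ultimately show ?thesis
    by (simp add: d_def)
qed

section \<open>Convergence of the disc means of Wermer's regularized kernels to the conjugate
  function\<close>

section \<open>Regularized Cauchy kernels\<close>

text \<open>For p < 1 the integrand is unbounded near \<open>a\<close>. The antiderivatives on
  either side of \<open>a\<close> remain continuous there, so the fundamental theorem with
  derivatives only in the interior applies to each half.\<close>

lemma has_integral_abs_powr:
  fixes a b p :: real
  assumes "0 \<le> a" "a \<le> b" "0 < p"
  shows "((\<lambda>s. \<bar>s - a\<bar> powr (p - 1)) has_integral (a powr p + (b - a) powr p) / p) {0..b}"
proof -
  have "((\<lambda>s. \<bar>s - a\<bar> powr (p - 1)) has_integral - ((a - a) powr p / p) - - ((a - 0) powr p / p)) {0..a}"
  proof (rule fundamental_theorem_of_calculus_interior)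
    show "continuous_on {0..a} (\<lambda>s. - ((a - s) powr p / p))"
      using assms by (intro continuous_intros continuous_on_powr') auto
    fix s assume "s \<in> {0<..<a}"
    then show "((\<lambda>s. - ((a - s) powr p / p)) has_vector_derivative \<bar>s - a\<bar> powr (p - 1)) (at s)"
      unfolding has_real_derivative_iff_has_vector_derivative[symmetric]
      using assms by (auto intro!: derivative_eq_intros simp: abs_if powr_diff field_simps)
  qed (use assms in auto)
  moreover have "((\<lambda>s. \<bar>s - a\<bar> powr (p - 1)) has_integral (b - a) powr p / p - (a - a) powr p / p) {a..b}"
  proof (rule fundamental_theorem_of_calculus_interior)
    show "continuous_on {a..b} (\<lambda>s. (s - a) powr p / p)"
      using assms by (intro continuous_intros continuous_on_powr') auto
    fix s assume "s \<in> {a<..<b}"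
    then show "((\<lambda>s. (s - a) powr p / p) has_vector_derivative \<bar>s - a\<bar> powr (p - 1)) (at s)"
      unfolding has_real_derivative_iff_has_vector_derivative[symmetric]
      using assms by (auto intro!: derivative_eq_intros simp: abs_if powr_diff field_simps)
  qed (use assms in auto)
  ultimately show ?thesis
    using has_integral_combine[of 0 a b] assms by (fastforce simp: add_divide_distrib)
qed

text \<open>The integrand is the polar weight 2 s times the circle mean of the Cauchy kernel. Only
  radii below |w| contribute, and they give |w|^2 / w = cnj w.\<close>

lemma has_integral_radial_mean:
  assumes "norm w \<le> \<rho>"
  shows "((\<lambda>s. 2 * of_real s * (if s < norm w then 1 / w else 0)) has_integral cnj w) {0..\<rho>}"
proof -
  have "((\<lambda>s. (2 * of_real s) * (1 / w)) has_integral (of_real ((norm w)\<^sup>2) - of_real (0\<^sup>2)) * (1 / w)) {0..norm w}"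
    by (intro has_integral_mult_left fundamental_theorem_of_calculus)
       (auto intro!: derivative_eq_intros has_vector_derivative_real_field simp: of_real_power)
  moreover have "(of_real ((norm w)\<^sup>2) - of_real (0\<^sup>2)) * (1 / w) = cnj w"
    by (cases "w = 0") (simp_all add: complex_norm_square del: of_real_power)
  ultimately have "((\<lambda>s. 2 * of_real s * (1 / w)) has_integral cnj w) {0..norm w}"
    by simp
  then have "((\<lambda>s. 2 * of_real s * (if s < norm w then 1 / w else 0)) has_integral cnj w) {0..norm w}"
    by (rule has_integral_spike_finite[of "{norm w}", rotated 2]) auto
  moreover have "((\<lambda>s. 2 * of_real s * (if s < norm w then 1 / w else 0)) has_integral 0) {norm w..\<rho>}"
    by (rule has_integral_is_0) auto
  ultimately show ?thesis
    using has_integral_combine[of 0 "norm w" \<rho>] assms by fastforce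
qed

text \<open>Since Re (a * b) is the real inner product of cnj a and b, the last condition says that
  v \<mapsto> f (cnj v) is a strictly monotone map of the plane. The model case is f = cnj, where
  the product equals |w - z|^2.\<close>

locale strictly_monotone_disc =
  fixes f :: "complex \<Rightarrow> complex" and \<rho> :: real
  assumes radius_pos: "0 < \<rho>"
    and continuous: "continuous_on (cball 0 \<rho>) f"
    and monotone: "\<And>w z. w \<in> cball 0 \<rho> \<Longrightarrow> z \<in> cball 0 \<rho> \<Longrightarrow> w \<noteq> z \<Longrightarrow>
          0 < Re ((w - z) * (f w - f z))"
begin

definition kernel :: "real \<Rightarrow> complex \<Rightarrow> complex \<Rightarrow> complex" where
  "kernel e w z = (f w - f z) / ((w - z) * (f w - f z) + of_real e)"

definition circle_mean :: "real \<Rightarrow> complex \<Rightarrow> real \<Rightarrow> complex" where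
  "circle_mean e w s = integral {0..1} (\<lambda>t. kernel e w (circle_point s t))"

text \<open>In polar coordinates this is 1 / pi times the area integral of the kernel over the disc.
  Iterated one-dimensional integrals make the circle means explicit and allow membership in an
  algebra to be shown one variable at a time.\<close>

definition disc_mean :: "real \<Rightarrow> complex \<Rightarrow> complex" where
  "disc_mean e w = integral {0..\<rho>} (\<lambda>s. 2 * of_real s * circle_mean e w s)"

lemma monotone_weak:
  assumes "w \<in> cball 0 \<rho>" "z \<in> cball 0 \<rho>"
  shows "0 \<le> Re ((w - z) * (f w - f z))"
  using monotone[OF assms] by (cases "w = z") auto

lemma kernel_denominator_nz:
  assumes "0 < e" "w \<in> cball 0 \<rho>" "z \<in> cball 0 \<rho>"
  shows "(w - z) * (f w - f z) + of_real e \<noteq> 0"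
proof
  assume "(w - z) * (f w - f z) + of_real e = 0"
  then have "Re ((w - z) * (f w - f z) + of_real e) = 0" by simp
  then show False using monotone_weak[OF assms(2,3)] assms(1) by simp
qed

lemma continuous_on_kernel:
  assumes "0 < e" "continuous_on A g" "continuous_on A h"
    "g ` A \<subseteq> cball 0 \<rho>" "h ` A \<subseteq> cball 0 \<rho>"
  shows "continuous_on A (\<lambda>x. kernel e (g x) (h x))"
  unfolding kernel_def
  using assms kernel_denominator_nz[OF assms(1)]
  by (intro continuous_intros continuous_on_compose2[OF continuous]) (auto simp: image_subset_iff)

text \<open>The parametrization \<open>G\<close> covers two uses: a single centre \<open>w\<close>,
  with \<open>X = {w}\<close>, and joint continuity in the point and the radius when a function of
  an algebra is substituted for w.\<close>

lemma continuous_on_circle_mean: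
  assumes "0 < e" "continuous_on X G" "G ` X \<subseteq> cball 0 \<rho>"
  shows "continuous_on (X \<times> {0..\<rho>}) (\<lambda>(x, s). circle_mean e (G x) s)"
proof -
  have "continuous_on ((X \<times> {0..\<rho>}) \<times> cbox 0 1)
      (\<lambda>(y, t). kernel e (G (fst y)) (circle_point (snd y) t))"
    unfolding case_prod_beta
  proof (rule continuous_on_kernel[OF assms(1)])
    show "continuous_on ((X \<times> {0..\<rho>}) \<times> cbox 0 1) (\<lambda>p. G (fst (fst p)))"
      by (rule continuous_on_compose2[OF assms(2)]) (auto intro!: continuous_intros)
    show "continuous_on ((X \<times> {0..\<rho>}) \<times> cbox 0 1) (\<lambda>p. circle_point (snd (fst p)) (snd p))"
      by (intro continuous_intros)
  qed (use assms in auto)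
  from integral_continuous_on_param[OF this] show ?thesis
    by (simp add: circle_mean_def case_prod_beta)
qed

text \<open>With u = (w - z) (f w - f z), the kernel is u / (u + e) divided by w - z, and u / (u +
  e) - 1 = - e / (u + e).\<close>

lemma kernel_error:
  assumes "0 < e" "w \<in> cball 0 \<rho>" "z \<in> cball 0 \<rho>" "w \<noteq> z"
  shows "norm (kernel e w z - 1 / (w - z)) =
    e / norm ((w - z) * (f w - f z) + of_real e) / norm (w - z)"
proof -
  define u where "u = (w - z) * (f w - f z) + of_real e"
  have "u \<noteq> 0" unfolding u_def using kernel_denominator_nz[OF assms(1-3)] .
  then have "kernel e w z - 1 / (w - z) = - (of_real e / u / (w - z))"
    using assms(4) unfolding kernel_def u_def[symmetric]
    by (simp add: divide_simps) (simp add: u_def algebra_simps)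
  then show ?thesis
    using assms(1) unfolding u_def[symmetric] by (simp add: norm_divide norm_mult)
qed

text \<open>The denominator has real part at least e, by monotonicity. The bound does not depend on
  e and controls the error near the diagonal.\<close>

lemma kernel_error_le:
  assumes "0 < e" "w \<in> cball 0 \<rho>" "z \<in> cball 0 \<rho>" "w \<noteq> z"
  shows "norm (kernel e w z - 1 / (w - z)) \<le> 1 / norm (w - z)"
proof -
  have "e \<le> Re ((w - z) * (f w - f z) + of_real e)"
    using monotone_weak[OF assms(2,3)] by simp
  also have "\<dots> \<le> norm ((w - z) * (f w - f z) + of_real e)"
    by (rule complex_Re_le_cmod)
  finally have "e / norm ((w - z) * (f w - f z) + of_real e) \<le> 1"
    using assms(1) by (simp add: divide_simps)
  then show ?thesis
    unfolding kernel_error[OF assms] by (intro divide_right_mono) auto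
qed

lemma kernel_error_far:
  assumes "0 < e" "w \<in> cball 0 \<rho>" "z \<in> cball 0 \<rho>" "0 < \<delta>" "\<delta> \<le> norm (w - z)"
    and "0 < c" "c \<le> Re ((w - z) * (f w - f z))"
  shows "norm (kernel e w z - 1 / (w - z)) \<le> e / (c * \<delta>)"
proof -
  have wz: "w \<noteq> z" using assms by auto
  have "c \<le> Re ((w - z) * (f w - f z) + of_real e)"
    using assms by simp
  also have "\<dots> \<le> norm ((w - z) * (f w - f z) + of_real e)"
    by (rule complex_Re_le_cmod)
  finally show ?thesis
    unfolding kernel_error[OF assms(1-3) wz] divide_divide_eq_left
    using assms by (intro divide_left_mono mult_mono mult_pos_pos) auto
qed

text \<open>A positive continuous function attains its minimum on the compact set of pairs at
  distance at least \<delta>. If there are no such pairs, any positive constant will do.\<close>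

lemma monotone_uniform:
  assumes "0 < \<delta>"
  obtains c where "0 < c"
    "\<And>w z. w \<in> cball 0 \<rho> \<Longrightarrow> z \<in> cball 0 \<rho> \<Longrightarrow> \<delta> \<le> norm (w - z) \<Longrightarrow> c \<le> Re ((w - z) * (f w - f z))"
proof (cases "{p \<in> cball (0::complex) \<rho> \<times> cball (0::complex) \<rho>. \<delta> \<le> norm (fst p - snd p)} = {}")
  case True
  then have "\<not> \<delta> \<le> norm (w - z)" if "w \<in> cball 0 \<rho>" "z \<in> cball 0 \<rho>" for w z :: complex
    using that equals0D[OF True, of "(w, z)"] by simp
  then show ?thesis by (intro that[of 1]) auto
next
  case False
  let ?P = "{p \<in> cball (0::complex) \<rho> \<times> cball (0::complex) \<rho>. \<delta> \<le> norm (fst p - snd p)}"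
  have "?P = (cball 0 \<rho> \<times> cball 0 \<rho>) \<inter> {p::complex \<times> complex. \<delta> \<le> norm (fst p - snd p)}"
    by auto
  moreover have "closed {p::complex \<times> complex. \<delta> \<le> norm (fst p - snd p)}"
    by (intro closed_Collect_le continuous_intros)
  ultimately have "compact ?P"
    by (simp add: compact_Int_closed compact_Times)
  moreover have "continuous_on ?P (\<lambda>p. Re ((fst p - snd p) * (f (fst p) - f (snd p))))"
    by (intro continuous_intros continuous_on_compose2[OF continuous]) auto
  ultimately have "\<exists>p\<in>?P. \<forall>q\<in>?P. Re ((fst p - snd p) * (f (fst p) - f (snd p))) \<le> Re ((fst q - snd q) * (f (fst q) - f (snd q)))"
    using False by (intro continuous_attains_inf)
  then obtain p where p: "p \<in> ?P" and
    min: "\<forall>q\<in>?P. Re ((fst p - snd p) * (f (fst p) - f (snd p))) \<le> Re ((fst q - snd q) * (f (fst q) - f (snd q)))"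
    by (rule bexE)
  show ?thesis
  proof (rule that)
    show "0 < Re ((fst p - snd p) * (f (fst p) - f (snd p)))"
      using p assms by (intro monotone) auto
    show "Re ((fst p - snd p) * (f (fst p) - f (snd p))) \<le> Re ((w - z) * (f w - f z))"
      if "w \<in> cball 0 \<rho>" "z \<in> cball 0 \<rho>" "\<delta> \<le> norm (w - z)" for w z
      using bspec[OF min, of "(w, z)"] that by simp
  qed
qed

lemma has_integral_circle_mean_error:
  assumes "0 < e" "w \<in> cball 0 \<rho>" "0 \<le> s" "s \<le> \<rho>" "s \<noteq> norm w"
  shows "((\<lambda>t. kernel e w (circle_point s t) - 1 / (w - circle_point s t)) has_integral
    circle_mean e w s - (if s < norm w then 1 / w else 0)) {0..1}"
proof -
  have "continuous_on {0..1} (\<lambda>t. kernel e w (circle_point s t))"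
    using assms by (intro continuous_on_kernel continuous_intros) auto
  then have "((\<lambda>t. kernel e w (circle_point s t)) has_integral circle_mean e w s) {0..1}"
    unfolding circle_mean_def by (intro integrable_integral integrable_continuous_real)
  then show ?thesis
    using assms by (intro has_integral_diff circle_mean_cauchy_kernel) auto
qed

text \<open>Every point of the circle of radius s has distance at least |s - |w|| from w, so the
  pointwise bound away from the diagonal holds on the whole circle.\<close>

lemma circle_mean_error_far:
  assumes "0 < e" "w \<in> cball 0 \<rho>" "0 \<le> s" "s \<le> \<rho>" "0 < \<delta>" "\<delta> \<le> \<bar>s - norm w\<bar>" "0 < c"
    and c: "\<And>z. z \<in> cball 0 \<rho> \<Longrightarrow> \<delta> \<le> norm (w - z) \<Longrightarrow> c \<le> Re ((w - z) * (f w - f z))"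
  shows "norm (circle_mean e w s - (if s < norm w then 1 / w else 0)) \<le> e / (c * \<delta>)"
proof -
  have "norm (circle_mean e w s - (if s < norm w then 1 / w else 0)) \<le> e / (c * \<delta>) * measure lborel {0..1::real}"
  proof (rule has_integral_bound_real[where S = "{}", OF _ _ has_integral_circle_mean_error])
    fix t :: real
    have "norm (circle_point s t) = s" using assms by simp
    then have "\<delta> \<le> norm (w - circle_point s t)"
      using assms(6) norm_triangle_ineq2[of w "circle_point s t"]
        norm_triangle_ineq2[of "circle_point s t" w] norm_minus_commute[of w "circle_point s t"]
      by linarith
    then show "norm (kernel e w (circle_point s t) - 1 / (w - circle_point s t)) \<le> e / (c * \<delta>)"
      using assms by (intro kernel_error_far c) auto
  qed (use assms in auto)
  then show ?thesis by simp
qed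

(* AM-GM bounds 1 / |w - zeta| by a multiple of the Poisson kernel, whose mean is explicit. *)
lemma circle_mean_error_le:
  assumes "0 < e" "w \<in> cball 0 \<rho>" "0 \<le> s" "s \<le> \<rho>" "s \<noteq> norm w"
  shows "norm (circle_mean e w s - (if s < norm w then 1 / w else 0)) \<le> 1 / sqrt \<bar>(norm w)\<^sup>2 - s\<^sup>2\<bar>"
proof -
  \<comment> \<open>This weight balances the two terms of the AM-GM bound: the mean of 1 / |w -
    zeta|^2 is 1 / l^2, so each term contributes 1 / (2 l).\<close>
  define l where "l = sqrt \<bar>(norm w)\<^sup>2 - s\<^sup>2\<bar>"
  have "(norm w)\<^sup>2 \<noteq> s\<^sup>2" using assms by (simp add: power2_eq_iff_nonneg)
  then have l: "l > 0" and l2: "\<bar>(norm w)\<^sup>2 - s\<^sup>2\<bar> = l\<^sup>2" by (auto simp: l_def)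
  have "((\<lambda>t. l / 2 * (1 / (norm (w - circle_point s t))\<^sup>2) + 1 / (2 * l)) has_integral
      l / 2 * (1 / l\<^sup>2) + 1 / (2 * l)) {0..1}"
    using has_integral_const_real[of "1 / (2 * l)" 0 1] circle_mean_square_kernel[OF assms(3,5)]
    unfolding l2 by (intro has_integral_add has_integral_mult_right) auto
  moreover have "l / 2 * (1 / l\<^sup>2) + 1 / (2 * l) = 1 / l"
    using l by (simp add: power2_eq_square field_simps)
  ultimately have bound: "((\<lambda>t. l / 2 * (1 / (norm (w - circle_point s t))\<^sup>2) + 1 / (2 * l)) has_integral 1 / l) {0..1}"
    by simp
  note err = has_integral_circle_mean_error[OF assms]
  have "norm (integral {0..1} (\<lambda>t. kernel e w (circle_point s t) - 1 / (w - circle_point s t))) \<le>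
      integral {0..1} (\<lambda>t. l / 2 * (1 / (norm (w - circle_point s t))\<^sup>2) + 1 / (2 * l))"
  proof (rule integral_norm_bound_integral)
    fix t :: real
    define d where "d = norm (w - circle_point s t)"
    have wz: "w \<noteq> circle_point s t" using assms by auto
    then have d: "d > 0" by (simp add: d_def)
    have "norm (kernel e w (circle_point s t) - 1 / (w - circle_point s t)) \<le> 1 / d"
      unfolding d_def using assms wz by (intro kernel_error_le) auto
    also have "1 / d \<le> l / 2 * (1 / d\<^sup>2) + 1 / (2 * l)"
    proof -
      have "l / 2 * (1 / d\<^sup>2) + 1 / (2 * l) - 1 / d = (l - d)\<^sup>2 / (2 * l * d\<^sup>2)"
        using d l by (simp add: field_simps power2_eq_square)
      also have "\<dots> \<ge> 0" using l by simp
      finally show ?thesis by simp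
    qed
    finally show "norm (kernel e w (circle_point s t) - 1 / (w - circle_point s t)) \<le>
        l / 2 * (1 / (norm (w - circle_point s t))\<^sup>2) + 1 / (2 * l)"
      by (simp add: d_def)
  qed (use err bound in \<open>auto simp: has_integral_integrable\<close>)
  then show ?thesis
    using err bound by (simp add: integral_unique l_def)
qed

text \<open>With d = |s - |w||, one has ||w|^2 - s^2| = d (|w| + s) \<ge> d s, and the polar weight
  absorbs the factor 1 / sqrt s. What remains is an integrable singularity at s = |w|, with a
  constant uniform in e and w.\<close>

lemma weighted_circle_mean_error_le:
  assumes "0 < e" "w \<in> cball 0 \<rho>" "0 \<le> s" "s \<le> \<rho>" "s \<noteq> norm w"
  shows "2 * s * norm (circle_mean e w s - (if s < norm w then 1 / w else 0))
    \<le> 2 * sqrt \<rho> * \<bar>s - norm w\<bar> powr (- 1 / 2)"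
proof (cases "s = 0")
  case False
  then have s: "s > 0" using assms by simp
  define d where "d = \<bar>s - norm w\<bar>"
  have d: "d > 0" using assms by (simp add: d_def)
  have "\<bar>(norm w)\<^sup>2 - s\<^sup>2\<bar> = d * (norm w + s)"
    using s by (simp add: d_def power2_eq_square square_diff_square_factored abs_mult abs_minus_commute)
  then have "d * s \<le> \<bar>(norm w)\<^sup>2 - s\<^sup>2\<bar>"
    using d by (simp add: mult_left_mono)
  then have "1 / sqrt \<bar>(norm w)\<^sup>2 - s\<^sup>2\<bar> \<le> 1 / sqrt (d * s)"
    using d s by (intro frac_le) auto
  with circle_mean_error_le[OF assms]
  have "norm (circle_mean e w s - (if s < norm w then 1 / w else 0)) \<le> 1 / sqrt (d * s)"
    by linarith
  then have "2 * s * norm (circle_mean e w s - (if s < norm w then 1 / w else 0)) \<le> 2 * s * (1 / sqrt (d * s))"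
    using s by (intro mult_left_mono) auto
  also have "\<dots> = 2 * (s / sqrt s) * (1 / sqrt d)"
    by (simp add: real_sqrt_mult)
  also have "\<dots> = 2 * sqrt s * (1 / sqrt d)"
    using s by (simp add: real_div_sqrt)
  also have "\<dots> \<le> 2 * sqrt \<rho> * (1 / sqrt d)"
    using assms d by (intro mult_right_mono) auto
  also have "1 / sqrt d = d powr (- 1 / 2)"
    using d powr_minus_divide[of d "1/2"] by (simp add: powr_half_sqrt)
  finally show ?thesis by (simp add: d_def)
qed (use radius_pos in simp)

text \<open>Radii with |s - |w|| \<ge> \<delta> contribute an error of order e, by the far bound.
  The remaining radii contribute a small power of \<delta>, uniformly in e, by the integrable
  bound.\<close>

lemma disc_mean_error:
  assumes "0 < e" "w \<in> cball 0 \<rho>" "0 < \<delta>" "0 < c"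
    and c: "\<And>z. z \<in> cball 0 \<rho> \<Longrightarrow> \<delta> \<le> norm (w - z) \<Longrightarrow> c \<le> Re ((w - z) * (f w - f z))"
  shows "norm (disc_mean e w - cnj w) \<le> 2 * \<rho>\<^sup>2 * e / (c * \<delta>) + 16 * sqrt \<rho> * \<rho> powr (1/4) * \<delta> powr (1/4)"
proof -
  define a where "a = norm w"
  define D where "D = (\<lambda>s. 2 * of_real s * circle_mean e w s - 2 * of_real s * (if s < a then 1 / w else 0))"
  \<comment> \<open>The circle mean estimates exclude s = |w|; changing the integrand at that one
    point leaves the integral alone.\<close>
  define E where "E = (\<lambda>s. if s = a then 0 else D s)"
  \<comment> \<open>One majorant serves both ranges of s. For d = |s - a| < \<delta>, d powr (-1/2)
    = d powr (1/4) * d powr (-3/4) \<le> \<delta> powr (1/4) * d powr (-3/4), and the last power is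
    integrable over all of \<open>{0..\<rho>}\<close>.\<close>
  define b where "b = (\<lambda>s. 2 * \<rho> * (e / (c * \<delta>)) + 2 * sqrt \<rho> * \<delta> powr (1/4) * \<bar>s - a\<bar> powr (1/4 - 1))"
  have a: "0 \<le> a" "a \<le> \<rho>" using assms by (auto simp: a_def)
  have "continuous_on ({w} \<times> {0..\<rho>}) (\<lambda>(x, s). circle_mean e x s)"
    using assms by (intro continuous_on_circle_mean) auto
  then have "continuous_on {0..\<rho>} (\<lambda>s. (\<lambda>(x, s). circle_mean e x s) (w, s))"
    by (rule continuous_on_compose2) (auto intro!: continuous_intros)
  then have "continuous_on {0..\<rho>} (\<lambda>s. 2 * of_real s * circle_mean e w s)"
    by (intro continuous_intros) auto
  then have "((\<lambda>s. 2 * of_real s * circle_mean e w s) has_integral disc_mean e w) {0..\<rho>}"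
    unfolding disc_mean_def by (intro integrable_integral integrable_continuous_real)
  then have "(D has_integral disc_mean e w - cnj w) {0..\<rho>}"
    unfolding D_def a_def using assms by (intro has_integral_diff has_integral_radial_mean) auto
  then have E: "(E has_integral disc_mean e w - cnj w) {0..\<rho>}"
    by (rule has_integral_spike_finite[of "{a}", rotated 2]) (auto simp: E_def)
  have b: "(b has_integral 2 * \<rho> * (e / (c * \<delta>)) * \<rho>
      + 2 * sqrt \<rho> * \<delta> powr (1/4) * ((a powr (1/4) + (\<rho> - a) powr (1/4)) / (1/4))) {0..\<rho>}"
    unfolding b_def
    using has_integral_const_real[of "2 * \<rho> * (e / (c * \<delta>))" 0 \<rho>] radius_pos a
    by (intro has_integral_add has_integral_mult_right has_integral_abs_powr) (auto simp: mult_ac)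
  have "norm (integral {0..\<rho>} E) \<le> integral {0..\<rho>} b"
  proof (rule integral_norm_bound_integral)
    fix s assume "s \<in> {0..\<rho>}"
    then have s: "0 \<le> s" "s \<le> \<rho>" by auto
    have nonneg: "0 \<le> 2 * \<rho> * (e / (c * \<delta>))" "0 \<le> 2 * sqrt \<rho> * \<delta> powr (1/4) * \<bar>s - a\<bar> powr (1/4 - 1)"
      using radius_pos assms by auto
    define err where "err = norm (circle_mean e w s - (if s < norm w then 1 / w else 0))"
    show "norm (E s) \<le> b s"
    proof (cases "s = a")
      case True
      then show ?thesis using nonneg by (simp add: E_def b_def)
    next
      case False
      have "D s = 2 * of_real s * (circle_mean e w s - (if s < norm w then 1 / w else 0))"
        unfolding D_def a_def by (simp only: right_diff_distrib)
      then have Es: "norm (E s) = 2 * s * err"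
        using False s by (simp add: E_def err_def norm_mult)
      show ?thesis
      proof (cases "\<delta> \<le> \<bar>s - a\<bar>")
        case True
        then have "err \<le> e / (c * \<delta>)"
          unfolding err_def using assms s by (intro circle_mean_error_far) (auto simp: a_def)
        then have "2 * s * err \<le> 2 * \<rho> * (e / (c * \<delta>))"
          using s by (intro mult_mono) (auto simp: err_def)
        then show ?thesis using nonneg Es by (simp add: b_def)
      next
        case near: False
        define d where "d = \<bar>s - a\<bar>"
        have d: "0 < d" "d < \<delta>" using near False by (auto simp: d_def)
        have "2 * s * err \<le> 2 * sqrt \<rho> * d powr (- 1 / 2)"
          unfolding err_def d_def a_def
          by (rule weighted_circle_mean_error_le) (use assms s False in \<open>auto simp: a_def\<close>)
        also have "d powr (- 1 / 2) = d powr (1/4) * d powr (1/4 - 1)"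
          by (simp flip: powr_add)
        also have "2 * sqrt \<rho> * \<dots> \<le> 2 * sqrt \<rho> * (\<delta> powr (1/4) * d powr (1/4 - 1))"
          using d radius_pos by (intro mult_left_mono mult_right_mono powr_mono2) auto
        finally show ?thesis using nonneg(1) Es by (simp add: b_def d_def mult.assoc)
      qed
    qed
  qed (use E b in \<open>auto simp: has_integral_integrable\<close>)
  then have "norm (disc_mean e w - cnj w) \<le> 2 * \<rho> * (e / (c * \<delta>)) * \<rho>
      + 2 * sqrt \<rho> * \<delta> powr (1/4) * ((a powr (1/4) + (\<rho> - a) powr (1/4)) / (1/4))"
    using E b by (simp add: integral_unique)
  also have "\<dots> \<le> 2 * \<rho> * (e / (c * \<delta>)) * \<rho>
      + 2 * sqrt \<rho> * \<delta> powr (1/4) * ((\<rho> powr (1/4) + \<rho> powr (1/4)) / (1/4))"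
    using a radius_pos by (intro add_left_mono mult_left_mono divide_right_mono add_mono powr_mono2) auto
  also have "\<dots> = 2 * \<rho>\<^sup>2 * e / (c * \<delta>) + 16 * sqrt \<rho> * \<rho> powr (1/4) * \<delta> powr (1/4)"
    by (simp add: power2_eq_square)
  finally show ?thesis .
qed

text \<open>The order of choices matters: \<delta> first, making the near error \<eta> / 3, then the
  monotonicity constant c for this \<delta>, and finally e, making the far error \<eta> / 3.\<close>

lemma disc_mean_uniform_limit:
  assumes "0 < \<eta>"
  obtains e where "0 < e" "\<And>w. w \<in> cball 0 \<rho> \<Longrightarrow> norm (disc_mean e w - cnj w) < \<eta>"
proof -
  define M where "M = 16 * sqrt \<rho> * \<rho> powr (1/4)"
  have M: "M > 0" using radius_pos by (simp add: M_def)
  define q where "q = \<eta> / (3 * M)"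
  have q: "q > 0" using M assms by (simp add: q_def)
  define \<delta> where "\<delta> = q powr (4::real)"
  have \<delta>: "\<delta> > 0" "\<delta> powr (1/4) = q"
    using q by (simp_all add: \<delta>_def powr_powr del: powr_numeral)
  obtain c where c: "0 < c" "\<And>w z. w \<in> cball 0 \<rho> \<Longrightarrow> z \<in> cball 0 \<rho> \<Longrightarrow> \<delta> \<le> norm (w - z) \<Longrightarrow> c \<le> Re ((w - z) * (f w - f z))"
    using monotone_uniform[OF \<delta>(1)] by blast
  define e where "e = \<eta> * (c * \<delta>) / (6 * \<rho>\<^sup>2)"
  have e: "0 < e" using assms c \<delta> radius_pos by (simp add: e_def)
  show ?thesis
  proof (rule that[OF e])
    fix w :: complex assume w: "w \<in> cball 0 \<rho>"
    have "norm (disc_mean e w - cnj w) \<le> 2 * \<rho>\<^sup>2 * e / (c * \<delta>) + M * \<delta> powr (1/4)"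
      unfolding M_def using c(2)[OF w] by (intro disc_mean_error e w \<delta>(1) c(1))
    also have "\<dots> = \<eta> / 3 + \<eta> / 3"
      using M c \<delta> radius_pos unfolding \<delta>(2) by (simp add: e_def q_def)
    also have "\<dots> < \<eta>" using assms by simp
    finally show "norm (disc_mean e w - cnj w) < \<eta>" .
  qed
qed

end

section \<open>Inverses, integrals and conjugates in a uniformly closed algebra of functions\<close>

section \<open>Uniformly closed algebras\<close>

text \<open>Members are total functions, but \<open>uniform_limit\<close> compares values on
  \<open>X\<close> only, so membership depends only on the restriction to \<open>X\<close>; this is
  \<open>cong\<close>.\<close>

locale uniformly_closed_algebra =
  fixes X :: "'a::metric_space set" and B :: "('a \<Rightarrow> complex) set"
  assumes compact_domain: "compact X"
    and continuous_on_member: "\<And>h. h \<in> B \<Longrightarrow> continuous_on X h"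
    and const: "\<And>c. (\<lambda>_. c) \<in> B"
    and add: "\<And>g h. g \<in> B \<Longrightarrow> h \<in> B \<Longrightarrow> (\<lambda>x. g x + h x) \<in> B"
    and mult: "\<And>g h. g \<in> B \<Longrightarrow> h \<in> B \<Longrightarrow> (\<lambda>x. g x * h x) \<in> B"
    and uniform_limit: "\<And>h. (\<And>e. 0 < e \<Longrightarrow> \<exists>g\<in>B. \<forall>x\<in>X. norm (h x - g x) < e) \<Longrightarrow> h \<in> B"
begin

lemma cong:
  assumes "g \<in> B" "\<And>x. x \<in> X \<Longrightarrow> g x = h x"
  shows "h \<in> B"
  by (rule uniform_limit) (use assms in force)

lemma diff: "g \<in> B \<Longrightarrow> h \<in> B \<Longrightarrow> (\<lambda>x. g x - h x) \<in> B"
  using add[of g "\<lambda>x. - 1 * h x"] mult[OF const[of "- 1"], of h] by simp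

lemma power: "g \<in> B \<Longrightarrow> (\<lambda>x. g x ^ n) \<in> B"
  by (induction n) (simp_all add: const mult)

lemma sum_lessThan: "(\<And>k. g k \<in> B) \<Longrightarrow> (\<lambda>x. \<Sum>k<n. g k x) \<in> B" for n :: nat
  by (induction n) (simp_all add: const add)

(* For small kappa > 0 one has |1 - kappa h| <= q < 1, so 1 / h is kappa times a geometric series. *)
lemma inverse:
  assumes h: "h \<in> B" and "0 < \<epsilon>" and Re: "\<And>x. x \<in> X \<Longrightarrow> \<epsilon> \<le> Re (h x)"
  shows "(\<lambda>x. 1 / h x) \<in> B"
proof -
  have "bounded (h ` X)"
    using h compact_domain by (intro compact_imp_bounded compact_continuous_image continuous_on_member)
  then obtain M where M: "0 < M" "\<And>x. x \<in> X \<Longrightarrow> norm (h x) \<le> M"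
    unfolding bounded_pos by auto
  \<comment> \<open>This value minimizes the bound 1 - 2 \<kappa> \<epsilon> + \<kappa>^2 M^2 for |1
    - \<kappa> h|^2; the minimum is 1 - \<kappa> \<epsilon>.\<close>
  define \<kappa> where "\<kappa> = \<epsilon> / M\<^sup>2"
  define \<phi> where "\<phi> = (\<lambda>x. 1 - of_real \<kappa> * h x)"
  \<comment> \<open>The maximum with 0 ensures q \<ge> 0 without comparing \<epsilon> and M, which
    are unrelated when X is empty.\<close>
  define q where "q = sqrt (max 0 (1 - \<kappa> * \<epsilon>))"
  have \<kappa>: "0 < \<kappa>" using M assms by (simp add: \<kappa>_def)
  have "\<phi> \<in> B"
    unfolding \<phi>_def by (intro diff mult const h)
  have q: "0 \<le> q" "q < 1" using \<kappa> assms by (auto simp: q_def)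
  have norm_\<phi>: "norm (\<phi> x) \<le> q" if "x \<in> X" for x
  proof -
    have "(norm (\<phi> x))\<^sup>2 = 1 - 2 * \<kappa> * Re (h x) + \<kappa>\<^sup>2 * (norm (h x))\<^sup>2"
      unfolding \<phi>_def cmod_power2 by (simp add: power2_eq_square algebra_simps)
    also have "\<dots> \<le> 1 - 2 * \<kappa> * \<epsilon> + \<kappa>\<^sup>2 * M\<^sup>2"
      using M(2)[OF that] Re[OF that] \<kappa> by (intro add_mono diff_mono mult_left_mono power_mono) auto
    also have "\<kappa>\<^sup>2 * M\<^sup>2 = \<kappa> * \<epsilon>"
      using M by (simp add: \<kappa>_def power2_eq_square)
    finally have "(norm (\<phi> x))\<^sup>2 \<le> max 0 (1 - \<kappa> * \<epsilon>)"
      by (intro max.coboundedI2) (simp add: mult.commute)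
    then show ?thesis unfolding q_def by (rule real_le_rsqrt)
  qed
  show ?thesis
  proof (rule uniform_limit)
    fix e :: real assume "0 < e"
    then obtain n where n: "q ^ n < e * \<epsilon>"
      using real_arch_pow_inv[of "e * \<epsilon>" q] q assms by auto
    show "\<exists>g\<in>B. \<forall>x\<in>X. norm (1 / h x - g x) < e"
    proof (intro bexI ballI)
      show "(\<lambda>x. of_real \<kappa> * (\<Sum>k<n. \<phi> x ^ k)) \<in> B"
        by (intro mult const sum_lessThan power \<open>\<phi> \<in> B\<close>)
      fix x assume x: "x \<in> X"
      have hx: "h x \<noteq> 0" "\<epsilon> \<le> norm (h x)"
        using Re[OF x] \<open>0 < \<epsilon>\<close> complex_Re_le_cmod[of "h x"] by auto
      have "h x * (of_real \<kappa> * (\<Sum>k<n. \<phi> x ^ k)) = 1 - \<phi> x ^ n"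
        unfolding one_diff_power_eq by (simp add: \<phi>_def)
      then have "1 / h x - of_real \<kappa> * (\<Sum>k<n. \<phi> x ^ k) = \<phi> x ^ n / h x"
        using hx by (simp add: field_simps)
      then have "norm (1 / h x - of_real \<kappa> * (\<Sum>k<n. \<phi> x ^ k)) = norm (\<phi> x) ^ n / norm (h x)"
        by (simp add: norm_divide norm_power)
      also have "\<dots> \<le> q ^ n / \<epsilon>"
        using hx assms norm_\<phi>[OF x] q by (intro frac_le power_mono) auto
      also have "\<dots> < e" using n assms by (simp add: field_simps)
      finally show "norm (1 / h x - of_real \<kappa> * (\<Sum>k<n. \<phi> x ^ k)) < e" .
    qed
  qed
qed

text \<open>Left Riemann sums are finite linear combinations of members, and joint uniform
  continuity on the compact product makes them converge uniformly in x.\<close>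

lemma integral_member:
  fixes k :: "'a \<Rightarrow> real \<Rightarrow> complex"
  assumes "a \<le> b" and cont: "continuous_on (X \<times> {a..b}) (\<lambda>(x, t). k x t)"
    and mem: "\<And>t. t \<in> {a..b} \<Longrightarrow> (\<lambda>x. k x t) \<in> B"
  shows "(\<lambda>x. integral {a..b} (k x)) \<in> B"
proof (rule uniform_limit)
  fix e :: real assume e: "0 < e"
  \<comment> \<open>The summand 1 keeps the denominator positive when a = b.\<close>
  define e' where "e' = e / (2 * (b - a + 1))"
  have e': "0 < e'" "e' * (b - a) < e"
  proof -
    have "e * (b - a) < e * (2 * (b - a + 1))"
      using e assms by (intro mult_strict_left_mono) auto
    then show "0 < e'" "e' * (b - a) < e"
      using e assms by (simp_all add: e'_def divide_simps)
  qed
  have "uniformly_continuous_on (X \<times> {a..b}) (\<lambda>(x, t). k x t)"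
    by (intro compact_uniformly_continuous cont compact_Times compact_domain compact_Icc)
  then obtain d where d: "0 < d" and unif: "\<And>p q. p \<in> X \<times> {a..b} \<Longrightarrow> q \<in> X \<times> {a..b} \<Longrightarrow>
      dist q p < d \<Longrightarrow> dist (case q of (x, t) \<Rightarrow> k x t) (case p of (x, t) \<Rightarrow> k x t) < e'"
    unfolding uniformly_continuous_on_def using e'(1) by meson
  have d': "norm (k x t' - k x t) < e'"
    if "x \<in> X" "t \<in> {a..b}" "t' \<in> {a..b}" "\<bar>t' - t\<bar> < d" for x t t'
    using unif[of "(x, t)" "(x, t')"] that by (simp add: dist_Pair_Pair dist_norm)
  have integrable: "k x integrable_on {u..v}" if "x \<in> X" "a \<le> u" "v \<le> b" for x u v
  proof (rule integrable_continuous_real)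
    have "continuous_on {u..v} (\<lambda>t. (\<lambda>(x, t). k x t) (x, t))"
      using that by (intro continuous_on_compose2[OF cont] continuous_intros) auto
    then show "continuous_on {u..v} (k x)" by simp
  qed
  \<comment> \<open>Induction on the number of subintervals: the prefix from a to c is covered by n
    pieces of length at most d / 2, and the error is proportional to its length.\<close>
  have "\<exists>g\<in>B. \<forall>x\<in>X. norm (integral {a..c} (k x) - g x) \<le> e' * (c - a)"
    if "c \<in> {a..b}" "c - a \<le> real n * (d / 2)" for c n
    using that
  proof (induction n arbitrary: c)
    case 0
    then show ?case by (intro bexI[of _ "\<lambda>_. 0"] const) auto
  next
    case (Suc n)
    \<comment> \<open>The last subinterval runs from c' to c and is cut off at a. Its length is at
      most d / 2, hence strictly below the modulus d.\<close>
    define c' where "c' = max a (c - d / 2)"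
    have c': "c' \<in> {a..b}" "c' \<le> c" "c - c' < d" "c' - a \<le> real n * (d / 2)"
      using Suc.prems d by (auto simp: c'_def max_def algebra_simps)
    obtain g where g: "g \<in> B" "\<And>x. x \<in> X \<Longrightarrow> norm (integral {a..c'} (k x) - g x) \<le> e' * (c' - a)"
      using Suc.IH[OF c'(1,4)] by blast
    show ?case
    proof (intro bexI ballI)
      show "(\<lambda>x. g x + of_real (c - c') * k x c') \<in> B"
        by (intro add mult const g mem c')
      fix x assume x: "x \<in> X"
      have "((\<lambda>t. k x t - k x c') has_integral integral {c'..c} (k x) - (c - c') *\<^sub>R k x c') {c'..c}"
        using has_integral_const_real[of "k x c'" c' c] c' Suc.prems x
        by (intro has_integral_diff integrable_integral integrable) (auto simp: algebra_simps)
      then have "norm (integral {c'..c} (k x) - (c - c') *\<^sub>R k x c') \<le> e' * measure lborel {c'..c}"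
      proof (rule has_integral_bound_real[of _ "{}", rotated 2])
        fix t assume "t \<in> {c'..c} - {}"
        then show "norm (k x t - k x c') \<le> e'"
          using c' Suc.prems(1) x by (intro less_imp_le[OF d']) auto
      qed (use e' in auto)
      then have 1: "norm (integral {c'..c} (k x) - of_real (c - c') * k x c') \<le> e' * (c - c')"
        using c' by (simp add: scaleR_conv_of_real)
      have "integral {a..c} (k x) = integral {a..c'} (k x) + integral {c'..c} (k x)"
        using c' Suc.prems x by (intro Henstock_Kurzweil_Integration.integral_combine[symmetric] integrable) auto
      then have "integral {a..c} (k x) - (g x + of_real (c - c') * k x c') =
          (integral {a..c'} (k x) - g x) + (integral {c'..c} (k x) - of_real (c - c') * k x c')"
        by (simp add: algebra_simps)
      also have "norm \<dots> \<le> e' * (c' - a) + e' * (c - c')"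
        by (intro norm_triangle_mono g x 1)
      also have "\<dots> = e' * (c - a)" by (simp add: algebra_simps)
      finally show "norm (integral {a..c} (k x) - (g x + of_real (c - c') * k x c')) \<le> e' * (c - a)" .
    qed
  qed
  note approx = this
  have "\<exists>n. b - a < real n * (d / 2)"
    by (rule reals_Archimedean3[rule_format]) (use d in simp)
  then obtain n where "b - a < real n * (d / 2)" ..
  then have "\<exists>g\<in>B. \<forall>x\<in>X. norm (integral {a..b} (k x) - g x) \<le> e' * (b - a)"
    using \<open>a \<le> b\<close> by (intro approx[of b n]) auto
  then obtain g where "g \<in> B" and g: "\<forall>x\<in>X. norm (integral {a..b} (k x) - g x) \<le> e' * (b - a)" ..
  have "norm (integral {a..b} (k x) - g x) < e" if "x \<in> X" for x
    using bspec[OF g that] e'(2) by linarith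
  with \<open>g \<in> B\<close> show "\<exists>g\<in>B. \<forall>x\<in>X. norm (integral {a..b} (k x) - g x) < e" by blast
qed

text \<open>For each z the kernel at G lies in B because its denominator has real part at least e.
  Two integrations keep the disc mean in B, and letting e tend to 0 gives cnj G. \<open>G\<close>
  stays general so that a power of z can be substituted for w.\<close>

lemma cnj_member:
  assumes "strictly_monotone_disc f \<rho>"
    and G: "G \<in> B" "G ` X \<subseteq> cball 0 \<rho>" and fG: "(\<lambda>x. f (G x)) \<in> B"
  shows "(\<lambda>x. cnj (G x)) \<in> B"
proof -
  interpret strictly_monotone_disc f \<rho> by fact
  have kernel: "(\<lambda>x. kernel e (G x) z) \<in> B" if "0 < e" "z \<in> cball 0 \<rho>" for e z
  proof -
    have "(\<lambda>x. 1 / ((G x - z) * (f (G x) - f z) + of_real e)) \<in> B"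
    proof (rule inverse[OF _ \<open>0 < e\<close>])
      show "(\<lambda>x. (G x - z) * (f (G x) - f z) + of_real e) \<in> B"
        by (intro add mult diff const G fG)
      show "e \<le> Re ((G x - z) * (f (G x) - f z) + of_real e)" if "x \<in> X" for x
        using monotone_weak[of "G x" z] that G \<open>z \<in> cball 0 \<rho>\<close> by (auto simp: image_subset_iff)
    qed
    then have "(\<lambda>x. (f (G x) - f z) * (1 / ((G x - z) * (f (G x) - f z) + of_real e))) \<in> B"
      by (intro mult diff const fG)
    then show ?thesis by (simp add: kernel_def)
  qed
  have circle: "(\<lambda>x. circle_mean e (G x) s) \<in> B" if "0 < e" "s \<in> {0..\<rho>}" for e s
    unfolding circle_mean_def
  proof (rule integral_member)
    show "continuous_on (X \<times> {0..1}) (\<lambda>(x, t). kernel e (G x) (circle_point s t))"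
      unfolding case_prod_beta
    proof (rule continuous_on_kernel)
      show "continuous_on (X \<times> {0..1::real}) (\<lambda>p. G (fst p))"
        by (rule continuous_on_compose2[OF continuous_on_member[OF G(1)]]) (auto intro: continuous_intros)
      show "continuous_on (X \<times> {0..1::real}) (\<lambda>p. circle_point s (snd p))"
        by (intro continuous_intros)
    qed (use that G in auto)
  qed (use that in \<open>auto intro!: kernel\<close>)
  have disc: "(\<lambda>x. disc_mean e (G x)) \<in> B" if "0 < e" for e
    unfolding disc_mean_def
  proof (rule integral_member)
    have "continuous_on (X \<times> {0..\<rho>}) (\<lambda>p. circle_mean e (G (fst p)) (snd p))"
      using continuous_on_circle_mean[OF that continuous_on_member[OF G(1)] G(2)]
      by (simp add: case_prod_beta)
    then show "continuous_on (X \<times> {0..\<rho>}) (\<lambda>(x, s). 2 * complex_of_real s * circle_mean e (G x) s)"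
      unfolding case_prod_beta by (intro continuous_intros)
  qed (use that radius_pos in \<open>auto intro!: mult const circle\<close>)
  show ?thesis
  proof (rule uniform_limit)
    fix \<eta> :: real assume "0 < \<eta>"
    then obtain e where "0 < e" "\<And>w. w \<in> cball 0 \<rho> \<Longrightarrow> norm (disc_mean e w - cnj w) < \<eta>"
      using disc_mean_uniform_limit by blast
    then show "\<exists>g\<in>B. \<forall>x\<in>X. norm (cnj (G x) - g x) < \<eta>"
      using disc[of e] G(2) by (intro bexI[of _ "\<lambda>x. disc_mean e (G x)"]) (auto simp: norm_minus_commute)
  qed
qed

lemma continuous_real_compose_member:
  fixes h :: "'a \<Rightarrow> real" and \<phi> :: "real \<Rightarrow> real"
  assumes h: "(\<lambda>x. of_real (h x)) \<in> B" and "continuous_on (h ` X) \<phi>"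
  shows "(\<lambda>x. of_real (\<phi> (h x))) \<in> B"
proof (rule uniform_limit)
  fix e :: real assume "0 < e"
  have "continuous_on X (\<lambda>x. Re (of_real (h x)))"
    by (intro continuous_intros continuous_on_member h)
  then have "compact (h ` X)"
    by (intro compact_continuous_image compact_domain) simp
  from Stone_Weierstrass_real_polynomial_function[OF this assms(2) \<open>0 < e\<close>]
  obtain p where p: "real_polynomial_function p" "\<And>y. y \<in> h ` X \<Longrightarrow> \<bar>\<phi> y - p y\<bar> < e"
    by blast
  from p(1) have "(\<lambda>x. of_real (p (h x))) \<in> B"
  proof induction
    case (linear p)
    have p: "p t = p 1 * t" for t
      using linear_cmul[OF bounded_linear.linear[OF linear], of t 1] by (simp add: mult.commute)
    have "complex_of_real (p (h x)) = of_real (p 1) * of_real (h x)" for x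
      unfolding of_real_mult[symmetric] by (rule arg_cong[OF p])
    with mult[OF const h, of "of_real (p 1)"] show ?case by (simp only:)
  qed (simp_all add: const add mult)
  then show "\<exists>g\<in>B. \<forall>x\<in>X. norm (complex_of_real (\<phi> (h x)) - g x) < e"
    using p(2) by (intro bexI[of _ "\<lambda>x. of_real (p (h x))"]) (auto simp flip: of_real_diff)
qed

end

text \<open>Re z and Im z are combinations of z and cnj z, so B contains all real polynomials in the
  two coordinates, and Stone-Weierstrass applies to real and imaginary parts.\<close>

lemma continuous_imp_member:
  assumes "uniformly_closed_algebra X B"
    and z: "(\<lambda>z. z) \<in> B" and cnj: "(\<lambda>z. cnj z) \<in> B" and h: "continuous_on X h"
  shows "h \<in> B"
proof -
  interpret uniformly_closed_algebra X B by fact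
  have Re: "(\<lambda>z. of_real (Re z)) \<in> B"
    by (rule cong[OF mult[OF const[of "1/2"] add[OF z cnj]]]) (simp add: complex_add_cnj)
  have Im: "(\<lambda>z. of_real (Im z)) \<in> B"
    by (rule cong[OF mult[OF const[of "1/(2*\<i>)"] diff[OF z cnj]]]) (simp add: complex_diff_cnj complex_eq_iff)
  have poly: "(\<lambda>z. of_real (p z)) \<in> B" if "real_polynomial_function p" for p
    using that
  proof induction
    case (linear p)
    interpret p: bounded_linear p by fact
    have p: "Re z * p 1 + Im z * p \<i> = p z" for z
    proof -
      have "z = Re z *\<^sub>R 1 + Im z *\<^sub>R \<i>" by (simp add: complex_eq_iff)
      then have "p z = p (Re z *\<^sub>R 1 + Im z *\<^sub>R \<i>)" by (rule arg_cong)
      then show ?thesis by (simp only: p.add p.scaleR real_scaleR_def)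
    qed
    have "of_real (Re z) * of_real (p 1) + of_real (Im z) * of_real (p \<i>) = complex_of_real (p z)" for z
      unfolding of_real_mult[symmetric] of_real_add[symmetric] by (rule arg_cong[OF p])
    moreover have "(\<lambda>z. of_real (Re z) * of_real (p 1) + of_real (Im z) * of_real (p \<i>)) \<in> B"
      by (intro add mult const Re Im)
    ultimately show ?case
      by (simp only:)
  qed (simp_all add: const add mult)
  show ?thesis
  proof (rule uniform_limit)
    fix e :: real assume "0 < e"
    from Stone_Weierstrass_polynomial_function[OF compact_domain h this]
    obtain p where p: "polynomial_function p" "\<forall>x\<in>X. norm (h x - p x) < e"
      by blast
    from p(1) have "real_polynomial_function (Re \<circ> p)" "real_polynomial_function (Im \<circ> p)"
      unfolding polynomial_function_def using bounded_linear_Re bounded_linear_Im by blast+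
    from poly[OF this(1)] poly[OF this(2)]
    have "(\<lambda>z. of_real (Re (p z)) + \<i> * of_real (Im (p z))) \<in> B"
      unfolding o_def by (intro add mult const)
    then have "p \<in> B" by (simp flip: complex_eq)
    with p(2) show "\<exists>g\<in>B. \<forall>x\<in>X. norm (h x - g x) < e" by blast
  qed
qed

(* With m = j + 1, the function |z|^2 = root m (z^m cnj z^m) lies in B, and cnj z is the uniform
   limit of z^j cnj z^m / (|z|^(2 j) + d) as d tends to 0. *)
lemma cnj_member_of_cnj_power:
  assumes "uniformly_closed_algebra X B"
    and z: "(\<lambda>z. z) \<in> B" and cnj: "(\<lambda>z. cnj z ^ m) \<in> B" and "1 \<le> m"
  shows "(\<lambda>z. cnj z) \<in> B"
proof -
  interpret uniformly_closed_algebra X B by fact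
  obtain j where j: "m = Suc j" using \<open>1 \<le> m\<close> by (cases m) auto
  have norm_power: "of_real ((norm z)\<^sup>2 ^ k) = z ^ k * cnj z ^ k" for z k
    by (simp only: of_real_power[of "(norm z)\<^sup>2"] complex_norm_square power_mult_distrib)
  have "(\<lambda>z. of_real ((norm z)\<^sup>2 ^ m)) \<in> B"
    unfolding norm_power by (rule mult[OF power[OF z] cnj])
  then have "(\<lambda>z. of_real (root m ((norm z)\<^sup>2 ^ m))) \<in> B"
    by (rule continuous_real_compose_member) (intro continuous_on_real_root continuous_on_id)
  moreover have "root m ((norm z)\<^sup>2 ^ m) = (norm z)\<^sup>2" for z :: complex
    using j by (intro real_root_power_cancel) auto
  ultimately have sq: "(\<lambda>z. of_real ((norm z)\<^sup>2)) \<in> B"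
    by (simp only:)
  have "bounded X" using compact_domain by (rule compact_imp_bounded)
  then obtain r where r: "0 < r" "\<And>z. z \<in> X \<Longrightarrow> norm z \<le> r"
    unfolding bounded_pos by auto
  show ?thesis
  proof (rule uniform_limit)
    fix e :: real assume e: "0 < e"
    \<comment> \<open>The error is |z| d / (t + d) with t = |z|^(2 j). It is at most |z| when |z|
      \<le> e / 2; otherwise t \<ge> (e / 2)^(2 j), and this d makes the bound r d / (e / 2)^(2 j)
      equal to e / 2.\<close>
    define d where "d = (e / 2)\<^sup>2 ^ j * e / (2 * r)"
    have d: "0 < d" using e r by (simp add: d_def)
    have "(\<lambda>z. 1 / (of_real ((norm z)\<^sup>2) ^ j + of_real d)) \<in> B"
    proof (rule inverse[OF add[OF power[OF sq] const] d])
      show "d \<le> Re (of_real ((norm z)\<^sup>2) ^ j + of_real d)" for z :: complex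
        unfolding of_real_power[symmetric] of_real_add[symmetric] Re_complex_of_real by simp
    qed
    then have mem: "(\<lambda>z. z ^ j * cnj z ^ m * (1 / (of_real ((norm z)\<^sup>2) ^ j + of_real d))) \<in> B"
      by (rule mult[OF mult[OF power[OF z] cnj]])
    have "norm (cnj z - z ^ j * cnj z ^ m * (1 / (of_real ((norm z)\<^sup>2) ^ j + of_real d))) < e"
      if "z \<in> X" for z
    proof -
      define t where "t = (norm z)\<^sup>2 ^ j"
      have t: "0 \<le> t" by (simp add: t_def)
      have "z ^ j * cnj z ^ m = cnj z * of_real t"
        unfolding t_def norm_power j by simp
      moreover have "of_real ((norm z)\<^sup>2) ^ j + of_real d = complex_of_real (t + d)"
        unfolding t_def of_real_add of_real_power ..
      moreover have "cnj z - cnj z * of_real t * (1 / of_real (t + d)) = cnj z * of_real (d / (t + d))"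
      proof -
        have "d / (t + d) = 1 - t * (1 / (t + d))" using t d by (simp add: field_simps)
        then have "cnj z * of_real (d / (t + d)) = cnj z * (1 - of_real t * (1 / of_real (t + d)))"
          by (simp only: of_real_diff of_real_mult of_real_divide of_real_1)
        then show ?thesis by (simp only: right_diff_distrib mult.assoc mult_1_right)
      qed
      ultimately have "norm (cnj z - z ^ j * cnj z ^ m * (1 / (of_real ((norm z)\<^sup>2) ^ j + of_real d))) =
          norm z * \<bar>d / (t + d)\<bar>"
        by (simp only: norm_mult norm_of_real complex_mod_cnj)
      also have "\<bar>d / (t + d)\<bar> = d / (t + d)" using t d by simp
      also have "norm z * \<dots> < e"
      proof (cases "norm z \<le> e / 2")
        case True
        have "norm z * (d / (t + d)) \<le> e / 2 * 1"
          using True t d e by (intro mult_mono) (auto simp: divide_simps)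
        then show ?thesis using e by linarith
      next
        case False
        then have "(e / 2)\<^sup>2 ^ j \<le> t"
          unfolding t_def using e by (intro power_mono) auto
        then have "norm z * (d / (t + d)) \<le> r * (d / (e / 2)\<^sup>2 ^ j)"
          using r(2)[OF that] t d e r by (intro mult_mono frac_le) auto
        also have "\<dots> = e / 2" using r e by (simp add: d_def)
        finally show ?thesis using e by linarith
      qed
      finally show ?thesis .
    qed
    then show "\<exists>g\<in>B. \<forall>z\<in>X. norm (cnj z - g z) < e"
      by (intro bexI[OF _ mem] ballI)
  qed
qed

section \<open>Closure properties of polynomials in two variables\<close>

section \<open>Polynomials in two variables and the graph\<close>

text \<open>Functions on the two-element index type correspond bijectively to pairs of exponents.
  The pair form makes the manipulation of finite sums direct.\<close>

lemma holomorphic_polynomial_2_iff: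
  fixes p :: "complex ^ 2 \<Rightarrow> complex"
  shows "holomorphic_polynomial p \<longleftrightarrow>
    (\<exists>(A :: (nat \<times> nat) set) c. finite A \<and> p = (\<lambda>x. \<Sum>(i, j)\<in>A. c (i, j) * (x $ 1 ^ i * x $ 2 ^ j)))"
    (is "_ \<longleftrightarrow> ?R")
proof
  assume "holomorphic_polynomial p"
  then obtain A :: "(2 \<Rightarrow> nat) set" and c where A: "finite A"
    and p: "p = (\<lambda>x. \<Sum>a\<in>A. c a * (\<Prod>i\<in>UNIV. x $ i ^ a i))"
    unfolding holomorphic_polynomial_def by blast
  define e where "e = (\<lambda>a :: 2 \<Rightarrow> nat. (a 1, a 2))"
  define d where "d = (\<lambda>(i, j) k. if k = (1::2) then i else (j::nat))"
  have de: "d (e a) = a" for a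
    by (rule ext) (use exhaust_2 in \<open>auto simp: d_def e_def\<close>)
  then have inj: "inj_on e A" by (metis inj_onI)
  have "p = (\<lambda>x. \<Sum>(i, j)\<in>(e ` A). (c \<circ> d) (i, j) * (x $ 1 ^ i * x $ 2 ^ j))"
    unfolding p sum.reindex[OF inj] o_def case_prod_beta prod.collapse de by (simp add: UNIV_2 e_def)
  with A show ?R by blast
next
  assume ?R
  then obtain A :: "(nat \<times> nat) set" and c where A: "finite A"
    and p: "p = (\<lambda>x. \<Sum>(i, j)\<in>A. c (i, j) * (x $ 1 ^ i * x $ 2 ^ j))"
    by blast
  define e where "e = (\<lambda>a :: 2 \<Rightarrow> nat. (a 1, a 2))"
  define d where "d = (\<lambda>(i, j) k. if k = (1::2) then i else (j::nat))"
  have ed: "e (d q) = q" for q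
    by (cases q) (simp add: d_def e_def)
  then have inj: "inj_on d A" by (metis inj_onI)
  have "p = (\<lambda>x. \<Sum>a\<in>(d ` A). (c \<circ> e) a * (\<Prod>i\<in>UNIV. x $ i ^ a i))"
    unfolding p sum.reindex[OF inj] o_def ed by (intro ext sum.cong) (auto simp: UNIV_2 d_def)
  with A show "holomorphic_polynomial p"
    unfolding holomorphic_polynomial_def by blast
qed

lemma holomorphic_polynomial_monomial:
  "holomorphic_polynomial (\<lambda>x :: complex ^ 2. a * (x $ 1 ^ i * x $ 2 ^ j))"
  unfolding holomorphic_polynomial_2_iff
  by (intro exI[of _ "{(i, j)}"] exI[of _ "\<lambda>_. a"]) simp

lemma holomorphic_polynomial_const: "holomorphic_polynomial (\<lambda>x :: complex ^ 2. a)"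
  using holomorphic_polynomial_monomial[of a 0 0] by simp

lemma holomorphic_polynomial_add:
  fixes p q :: "complex ^ 2 \<Rightarrow> complex"
  assumes "holomorphic_polynomial p" "holomorphic_polynomial q"
  shows "holomorphic_polynomial (\<lambda>x. p x + q x)"
proof -
  obtain A :: "(nat \<times> nat) set" and c where A: "finite A"
    and p: "p = (\<lambda>x. \<Sum>(i, j)\<in>A. c (i, j) * (x $ 1 ^ i * x $ 2 ^ j))"
    using assms unfolding holomorphic_polynomial_2_iff by blast
  obtain B :: "(nat \<times> nat) set" and d where B: "finite B"
    and q: "q = (\<lambda>x. \<Sum>(i, j)\<in>B. d (i, j) * (x $ 1 ^ i * x $ 2 ^ j))"
    using assms unfolding holomorphic_polynomial_2_iff by blast
  \<comment> \<open>Coefficients are extended by 0, so that both sums can run over the union of the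
    exponent sets.\<close>
  define c' where "c' = (\<lambda>k. if k \<in> A then c k else 0)"
  define d' where "d' = (\<lambda>k. if k \<in> B then d k else 0)"
  have p': "p = (\<lambda>x. \<Sum>(i, j)\<in>A \<union> B. c' (i, j) * (x $ 1 ^ i * x $ 2 ^ j))"
    unfolding p using A B by (intro ext sum.mono_neutral_cong_left) (auto simp: c'_def)
  have q': "q = (\<lambda>x. \<Sum>(i, j)\<in>A \<union> B. d' (i, j) * (x $ 1 ^ i * x $ 2 ^ j))"
    unfolding q using A B by (intro ext sum.mono_neutral_cong_left) (auto simp: d'_def)
  have "(\<lambda>x. p x + q x) = (\<lambda>x. \<Sum>(i, j)\<in>A \<union> B. (\<lambda>k. c' k + d' k) (i, j) * (x $ 1 ^ i * x $ 2 ^ j))"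
    unfolding p' q' sum.distrib[symmetric] case_prod_beta distrib_right ..
  moreover have "finite (A \<union> B)" using A B by simp
  ultimately show ?thesis
    unfolding holomorphic_polynomial_2_iff by (intro exI conjI)
qed

lemma holomorphic_polynomial_sum:
  fixes p :: "'i \<Rightarrow> complex ^ 2 \<Rightarrow> complex"
  assumes "\<And>i. i \<in> I \<Longrightarrow> holomorphic_polynomial (p i)"
  shows "holomorphic_polynomial (\<lambda>x. \<Sum>i\<in>I. p i x)"
  using assms
  by (induction I rule: infinite_finite_induct)
     (simp_all add: holomorphic_polynomial_const holomorphic_polynomial_add)

text \<open>In the expanded double sum the same exponent pair may occur repeatedly. Closure under
  finite sums makes collecting coefficients unnecessary.\<close>

lemma holomorphic_polynomial_mult:
  fixes p q :: "complex ^ 2 \<Rightarrow> complex"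
  assumes "holomorphic_polynomial p" "holomorphic_polynomial q"
  shows "holomorphic_polynomial (\<lambda>x. p x * q x)"
proof -
  obtain A :: "(nat \<times> nat) set" and c where
    p: "p = (\<lambda>x. \<Sum>(i, j)\<in>A. c (i, j) * (x $ 1 ^ i * x $ 2 ^ j))"
    using assms unfolding holomorphic_polynomial_2_iff by blast
  obtain B :: "(nat \<times> nat) set" and d where
    q: "q = (\<lambda>x. \<Sum>(i, j)\<in>B. d (i, j) * (x $ 1 ^ i * x $ 2 ^ j))"
    using assms unfolding holomorphic_polynomial_2_iff by blast
  have "(\<lambda>x. p x * q x) = (\<lambda>x. \<Sum>k\<in>A. \<Sum>l\<in>B.
      (c k * d l) * (x $ 1 ^ (fst k + fst l) * x $ 2 ^ (snd k + snd l)))"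
    unfolding p q sum_product case_prod_beta prod.collapse power_add by (simp only: mult_ac)
  then show ?thesis
    by (simp only:) (intro holomorphic_polynomial_sum holomorphic_polynomial_monomial)
qed

lemma continuous_on_holomorphic_polynomial:
  fixes p :: "complex ^ 2 \<Rightarrow> complex"
  assumes "holomorphic_polynomial p"
  shows "continuous_on X p"
proof -
  obtain A :: "(nat \<times> nat) set" and c where
    p: "p = (\<lambda>x. \<Sum>(i, j)\<in>A. c (i, j) * (x $ 1 ^ i * x $ 2 ^ j))"
    using assms unfolding holomorphic_polynomial_2_iff by blast
  show ?thesis
    unfolding p case_prod_beta by (intro continuous_intros)
qed

section \<open>Uniform approximation by polynomials on a graph, and its consequences\<close>

lemma graph_over_eq_image: "graph_over K F = (\<lambda>z. vector [z, F z]) ` K"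
  unfolding graph_over_def by auto

lemma continuous_on_vector_2:
  fixes f g :: "'a::topological_space \<Rightarrow> complex"
  assumes "continuous_on K f" "continuous_on K g"
  shows "continuous_on K (\<lambda>z. vector [f z, g z] :: complex ^ 2)"
proof -
  have "(\<lambda>z. vector [f z, g z] :: complex ^ 2) = (\<lambda>z. \<chi> i. if i = 1 then f z else g z)"
    unfolding vec_eq_iff fun_eq_iff by (simp add: forall_2)
  moreover have "continuous_on K (\<lambda>z. if i = 1 then f z else g z)" for i :: 2
    using assms by (cases "i = 1") simp_all
  ultimately show ?thesis
    by (simp only:) (rule continuous_on_vec_lambda)
qed

text \<open>An epsilon form of [z, F] on total functions, which avoids \<open>restrict\<close> and
  the function space metric until \<open>uniform_algebra_eq_C_space\<close>.\<close>

definition polynomially_approximable :: "complex set \<Rightarrow> (complex \<Rightarrow> complex) \<Rightarrow> (complex \<Rightarrow> complex) set" where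
  "polynomially_approximable K F = {h. \<forall>e>0. \<exists>p :: complex ^ 2 \<Rightarrow> complex. holomorphic_polynomial p \<and>
     (\<forall>z\<in>K. norm (h z - p (vector [z, F z])) < e)}"

lemma polynomially_approximable_I:
  fixes p :: "complex ^ 2 \<Rightarrow> complex"
  assumes "holomorphic_polynomial p" "\<And>z. z \<in> K \<Longrightarrow> h z = p (vector [z, F z])"
  shows "h \<in> polynomially_approximable K F"
  unfolding polynomially_approximable_def using assms by (auto intro!: exI[of _ p])

lemma polynomially_approximable_D:
  assumes "h \<in> polynomially_approximable K F" "0 < e"
  obtains p :: "complex ^ 2 \<Rightarrow> complex"
  where "holomorphic_polynomial p" "\<And>z. z \<in> K \<Longrightarrow> norm (h z - p (vector [z, F z])) < e"
  using assms unfolding polynomially_approximable_def by blast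

lemma uniformly_closed_algebra_polynomially_approximable:
  assumes K: "compact K" and F: "continuous_on K F"
  shows "uniformly_closed_algebra K (polynomially_approximable K F)"
proof
  have cont: "continuous_on K (\<lambda>z. p (vector [z, F z]))" if "holomorphic_polynomial p" for p :: "complex ^ 2 \<Rightarrow> complex"
    by (rule continuous_on_compose2[OF continuous_on_holomorphic_polynomial[OF that, of UNIV]
          continuous_on_vector_2[OF continuous_on_id F]]) auto
  show continuous: "continuous_on K h" if h: "h \<in> polynomially_approximable K F" for h
    unfolding continuous_on_iff
  proof (intro ballI allI impI)
    fix e :: real and z assume "z \<in> K" "0 < e"
    then have "0 < e / 3" by simp
    then obtain p :: "complex ^ 2 \<Rightarrow> complex" where p: "holomorphic_polynomial p"
      "\<And>z. z \<in> K \<Longrightarrow> norm (h z - p (vector [z, F z])) < e / 3"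
      using polynomially_approximable_D[OF h] by metis
    have "\<exists>d>0. \<forall>y\<in>K. dist y z < d \<longrightarrow> dist (p (vector [y, F y])) (p (vector [z, F z])) < e / 3"
      using bspec[OF cont[OF p(1), unfolded continuous_on_iff] \<open>z \<in> K\<close>] \<open>0 < e / 3\<close> by blast
    then obtain d where "0 < d" and d: "\<forall>y\<in>K. dist y z < d \<longrightarrow> dist (p (vector [y, F y])) (p (vector [z, F z])) < e / 3"
      by (elim exE conjE)
    have "dist (h y) (h z) < e" if y: "y \<in> K" "dist y z < d" for y
    proof -
      have "norm (h y - h z) \<le> norm (h y - p (vector [y, F y])) +
          norm (p (vector [y, F y]) - p (vector [z, F z])) + norm (h z - p (vector [z, F z]))"
        using norm_triangle_mono[OF norm_triangle_ineq order.refl, of "h y - p (vector [y, F y])"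
            "p (vector [y, F y]) - p (vector [z, F z])" "p (vector [z, F z]) - h z"]
        by (simp add: norm_minus_commute)
      then show ?thesis
        using p(2)[OF y(1)] p(2)[OF \<open>z \<in> K\<close>] d[rule_format, OF y] unfolding dist_norm by linarith
    qed
    with \<open>0 < d\<close> show "\<exists>d>0. \<forall>y\<in>K. dist y z < d \<longrightarrow> dist (h y) (h z) < e" by blast
  qed
  show "(\<lambda>_. c) \<in> polynomially_approximable K F" for c
    by (rule polynomially_approximable_I[OF holomorphic_polynomial_const]) simp
  fix g h assume g: "g \<in> polynomially_approximable K F" and h: "h \<in> polynomially_approximable K F"
  show "(\<lambda>x. g x + h x) \<in> polynomially_approximable K F"
    unfolding polynomially_approximable_def
  proof (intro CollectI allI impI)
    fix e :: real assume "0 < e"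
    then have "0 < e / 2" by simp
    obtain p q :: "complex ^ 2 \<Rightarrow> complex" where pq: "holomorphic_polynomial p" "holomorphic_polynomial q"
      "\<And>z. z \<in> K \<Longrightarrow> norm (g z - p (vector [z, F z])) < e / 2"
      "\<And>z. z \<in> K \<Longrightarrow> norm (h z - q (vector [z, F z])) < e / 2"
      using polynomially_approximable_D[OF g \<open>0 < e / 2\<close>] polynomially_approximable_D[OF h \<open>0 < e / 2\<close>] by metis
    have "norm (g z + h z - (p (vector [z, F z]) + q (vector [z, F z]))) < e" if "z \<in> K" for z
      using norm_add_less[OF pq(3)[OF that] pq(4)[OF that]] by (simp add: algebra_simps)
    then show "\<exists>p :: complex ^ 2 \<Rightarrow> complex. holomorphic_polynomial p \<and> (\<forall>z\<in>K. norm (g z + h z - p (vector [z, F z])) < e)"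
      by (intro exI[of _ "\<lambda>x. p x + q x"]) (simp add: holomorphic_polynomial_add pq)
  qed
  show "(\<lambda>x. g x * h x) \<in> polynomially_approximable K F"
    unfolding polynomially_approximable_def
  proof (intro CollectI allI impI)
    fix e :: real assume e: "0 < e"
    have "bounded (g ` K)" "bounded (h ` K)"
      using K by (intro compact_imp_bounded compact_continuous_image continuous g h; assumption)+
    then obtain M N where M: "0 < M" "\<And>z. z \<in> K \<Longrightarrow> norm (g z) \<le> M"
      and N: "0 < N" "\<And>z. z \<in> K \<Longrightarrow> norm (h z) \<le> N"
      unfolding bounded_pos by auto
    \<comment> \<open>The bound d \<le> 1 gives |q| \<le> N + 1 on the graph. From g h - p q = g (h
      - q) + (g - p) q the total error is then at most d (M + N + 1).\<close>
    define d where "d = min 1 (e / (2 * (M + N + 1)))"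
    have d: "0 < d" "d \<le> 1" using e M N by (auto simp: d_def)
    have "d * (M + N + 1) \<le> e / (2 * (M + N + 1)) * (M + N + 1)"
      using M N by (intro mult_right_mono) (auto simp: d_def)
    also have "\<dots> = e / 2" using M N by (simp add: field_simps)
    finally have de: "d * (M + N + 1) < e" using e by linarith
    obtain p q :: "complex ^ 2 \<Rightarrow> complex" where pq: "holomorphic_polynomial p" "holomorphic_polynomial q"
      "\<And>z. z \<in> K \<Longrightarrow> norm (g z - p (vector [z, F z])) < d"
      "\<And>z. z \<in> K \<Longrightarrow> norm (h z - q (vector [z, F z])) < d"
      using polynomially_approximable_D[OF g d(1)] polynomially_approximable_D[OF h d(1)] by metis
    have "norm (g z * h z - p (vector [z, F z]) * q (vector [z, F z])) < e" if z: "z \<in> K" for z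
    proof -
      define a b where "a = p (vector [z, F z])" and "b = q (vector [z, F z])"
      have ab: "norm (g z - a) \<le> d" "norm (h z - b) \<le> d"
        using pq(3,4)[OF z] by (simp_all add: a_def b_def less_imp_le)
      have "norm b \<le> N + 1"
        using N(2)[OF z] ab(2) d(2) norm_triangle_ineq2[of b "h z"] norm_minus_commute[of b "h z"] by linarith
      have "g z * h z - a * b = g z * (h z - b) + (g z - a) * b" by (simp add: algebra_simps)
      also have "norm \<dots> \<le> M * d + d * (N + 1)"
        using M N z ab d \<open>norm b \<le> N + 1\<close>
        by (intro norm_triangle_mono) (auto simp: norm_mult intro!: mult_mono)
      also have "\<dots> < e" using de by (simp add: algebra_simps)
      finally show ?thesis by (simp add: a_def b_def)
    qed
    then show "\<exists>p :: complex ^ 2 \<Rightarrow> complex. holomorphic_polynomial p \<and> (\<forall>z\<in>K. norm (g z * h z - p (vector [z, F z])) < e)"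
      by (intro exI[of _ "\<lambda>x. p x * q x"]) (simp add: holomorphic_polynomial_mult pq)
  qed
next
  fix h assume h: "\<And>e. 0 < e \<Longrightarrow> \<exists>g\<in>polynomially_approximable K F. \<forall>x\<in>K. norm (h x - g x) < e"
  show "h \<in> polynomially_approximable K F"
    unfolding polynomially_approximable_def
  proof (intro CollectI allI impI)
    fix e :: real assume "0 < e"
    then have e: "0 < e / 2" by simp
    obtain g where g: "g \<in> polynomially_approximable K F" "\<And>x. x \<in> K \<Longrightarrow> norm (h x - g x) < e / 2"
      using h[OF e] by blast
    obtain p :: "complex ^ 2 \<Rightarrow> complex" where p: "holomorphic_polynomial p"
      "\<And>z. z \<in> K \<Longrightarrow> norm (g z - p (vector [z, F z])) < e / 2"
      using polynomially_approximable_D[OF g(1) e] by metis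
    have "norm (h z - p (vector [z, F z])) < e" if "z \<in> K" for z
      using norm_add_less[OF g(2)[OF that] p(2)[OF that]] by simp
    with p(1) show "\<exists>p :: complex ^ 2 \<Rightarrow> complex. holomorphic_polynomial p \<and> (\<forall>z\<in>K. norm (h z - p (vector [z, F z])) < e)"
      by blast
  qed
qed (fact K)

lemma id_polynomially_approximable: "(\<lambda>z. z) \<in> polynomially_approximable K F"
  using holomorphic_polynomial_monomial[of 1 1 0] by (intro polynomially_approximable_I) auto

lemma second_polynomially_approximable: "F \<in> polynomially_approximable K F"
  using holomorphic_polynomial_monomial[of 1 0 1] by (intro polynomially_approximable_I) auto

text \<open>The metric closure is described by closed balls, so a pointwise bound by e yields the
  required distance. Restricted polynomials are continuous and extensional, hence points of the
  space.\<close>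

lemma uniform_algebra_eq_C_space:
  assumes K: "compact K" and F: "continuous_on K F"
    and dense: "\<And>h. continuous_on K h \<Longrightarrow> h \<in> polynomially_approximable K F"
  shows "uniform_algebra K (\<lambda>z. z) F = mspace (C_space K)"
proof -
  let ?C = "C_space K"
  have mspace: "mspace ?C = {f. f \<in> extensional K \<and> continuous_on K f}"
    using K unfolding C_space_def
    by (subst compactin_mspace_cfunspace) (auto simp: compactin_subtopology)
  interpret C: Metric_space "mspace ?C" "mdist ?C" by simp
  have "mtopology_of ?C closure_of {restrict (\<lambda>z. p (vector [z, F z] :: complex ^ 2)) K | p. holomorphic_polynomial p} = mspace ?C"
    unfolding mtopology_of_def C.metric_closure_of_alt
  proof (intro equalityI subsetI CollectI conjI allI impI)
    fix h and e :: real assume h: "h \<in> mspace ?C" and "0 < e"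
    then have "h \<in> polynomially_approximable K F"
      using dense by (auto simp: mspace)
    then obtain p :: "complex ^ 2 \<Rightarrow> complex" where p: "holomorphic_polynomial p"
      "\<And>z. z \<in> K \<Longrightarrow> norm (h z - p (vector [z, F z])) < e"
      using polynomially_approximable_D[OF _ \<open>0 < e\<close>] by metis
    define g where "g = restrict (\<lambda>z. p (vector [z, F z])) K"
    have "continuous_on K (\<lambda>z. p (vector [z, F z]))"
      by (rule continuous_on_compose2[OF continuous_on_holomorphic_polynomial[OF p(1), of UNIV]
            continuous_on_vector_2[OF continuous_on_id F]]) auto
    then have "continuous_on K g"
      by (rule continuous_on_eq) (simp add: g_def)
    then have "g \<in> mspace ?C"
      unfolding mspace by (simp add: g_def)
    moreover have "mdist ?C h g \<le> e"
      unfolding C_space_def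
      using p(2) \<open>0 < e\<close> by (intro mdist_cfunspace_le) (auto simp: g_def dist_norm less_imp_le)
    ultimately have "g \<in> C.mcball h e" using h by simp
    then show "\<exists>g\<in>{restrict (\<lambda>z. p (vector [z, F z] :: complex ^ 2)) K | p. holomorphic_polynomial p}. g \<in> C.mcball h e"
      using p(1) g_def by blast
  qed auto
  then show ?thesis by (simp add: uniform_algebra_def)
qed

lemma polynomially_convex_graph:
  assumes K: "compact K" "K \<noteq> {}" and F: "continuous_on K F"
    and dense: "\<And>h. continuous_on K h \<Longrightarrow> h \<in> polynomially_approximable K F"
  shows "polynomially_convex (graph_over K F)"
  unfolding polynomially_convex_def
proof (intro conjI equalityI subsetI)
  show compact: "compact (graph_over K F)"
    unfolding graph_over_eq_image
    by (intro compact_continuous_image continuous_on_vector_2 F K continuous_on_id)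
  \<comment> \<open>A real supremum is known to be an upper bound only for a set bounded above, so
    boundedness on the graph comes first.\<close>
  have bdd: "bdd_above ((\<lambda>x. norm (p x)) ` graph_over K F)" if "holomorphic_polynomial p" for p :: "complex ^ 2 \<Rightarrow> complex"
    by (intro bounded_imp_bdd_above compact_imp_bounded compact_continuous_image compact
        continuous_on_norm continuous_on_holomorphic_polynomial that)
  show "x \<in> polynomial_hull (graph_over K F)" if "x \<in> graph_over K F" for x
    unfolding polynomial_hull_def by (intro CollectI allI impI cSUP_upper that bdd)
  fix x assume x: "x \<in> polynomial_hull (graph_over K F)"
  show "x \<in> graph_over K F"
  proof (rule ccontr)
    assume notin: "x \<notin> graph_over K F"
    define a b where "a = x $ 1" and "b = x $ 2"
    have x_eq: "x = vector [a, b]"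
      unfolding a_def b_def vec_eq_iff by (simp add: forall_2)
    \<comment> \<open>This is |z - a|^2 + |F z - b|^2, the squared distance from (a, b) to the graph
      point over z, so it has no zero on K.\<close>
    define g where "g = (\<lambda>z. (z - a) * cnj (z - a) + (F z - b) * cnj (F z - b))"
    have g_eq: "g z = of_real ((norm (z - a))\<^sup>2 + (norm (F z - b))\<^sup>2)" for z
      unfolding g_def of_real_add complex_norm_square by simp
    have g: "g z \<noteq> 0" if "z \<in> K" for z
    proof
      assume "g z = 0"
      then have "(norm (z - a))\<^sup>2 + (norm (F z - b))\<^sup>2 = 0"
        unfolding g_eq by (simp only: of_real_eq_0_iff)
      then have "a = z" "b = F z"
        by (metis sum_power2_eq_zero_iff norm_eq_zero right_minus_eq)+
      then have "x = vector [z, F z]" by (simp only: x_eq)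
      with that notin show False unfolding graph_over_eq_image by simp
    qed
    \<comment> \<open>Conjugates divided by g give continuous solutions of (z - a) h1 + (F z - b) h2
      = 1.\<close>
    define h1 h2 where "h1 = (\<lambda>z. cnj (z - a) / g z)" and "h2 = (\<lambda>z. cnj (F z - b) / g z)"
    have "continuous_on K g"
      unfolding g_def by (intro continuous_intros F)
    then have "continuous_on K h1" "continuous_on K h2"
      unfolding h1_def h2_def using F g
      by (simp_all add: continuous_on_divide continuous_on_cnj continuous_on_diff)
    note h = this[THEN dense]
    have h12: "(z - a) * h1 z + (F z - b) * h2 z = 1" if "z \<in> K" for z
    proof -
      have "(z - a) * h1 z + (F z - b) * h2 z = g z / g z"
        by (simp only: h1_def h2_def times_divide_eq_right add_divide_distrib[symmetric] g_def)
      then show ?thesis using g[OF that] by simp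
    qed
    have "bounded ((\<lambda>z. z - a) ` K)" "bounded ((\<lambda>z. F z - b) ` K)"
      by (intro compact_imp_bounded compact_continuous_image continuous_intros F K)+
    then obtain M N where MN: "0 < M" "\<forall>y\<in>(\<lambda>z. z - a) ` K. norm y \<le> M"
      "0 < N" "\<forall>y\<in>(\<lambda>z. F z - b) ` K. norm y \<le> N"
      unfolding bounded_pos by (elim exE conjE)
    then have M: "0 < M" "\<And>z. z \<in> K \<Longrightarrow> norm (z - a) \<le> M"
      and N: "0 < N" "\<And>z. z \<in> K \<Longrightarrow> norm (F z - b) \<le> N"
      by simp_all
    \<comment> \<open>The total error (M + N) d is then 1 / 2, strictly below the value 1 taken by
      the separating polynomial at (a, b).\<close>
    define d where "d = 1 / (2 * (M + N))"
    have d: "0 < d" using M N by (simp add: d_def)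
    obtain p1 p2 :: "complex ^ 2 \<Rightarrow> complex" where p: "holomorphic_polynomial p1" "holomorphic_polynomial p2"
      "\<And>z. z \<in> K \<Longrightarrow> norm (h1 z - p1 (vector [z, F z])) < d"
      "\<And>z. z \<in> K \<Longrightarrow> norm (h2 z - p2 (vector [z, F z])) < d"
      using polynomially_approximable_D[OF h(1) d] polynomially_approximable_D[OF h(2) d] by metis
    \<comment> \<open>Both products vanish at (a, b), so q is 1 there. Differences are written as
      sums and products to fit the closure lemmas for polynomials.\<close>
    define q where "q = (\<lambda>y :: complex ^ 2. 1 + ((- a + y $ 1) * (- 1 * p1 y) + (- b + y $ 2) * (- 1 * p2 y)))"
    have "holomorphic_polynomial q"
      unfolding q_def
      using holomorphic_polynomial_monomial[of 1 1 0] holomorphic_polynomial_monomial[of 1 0 1] p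
      by (intro holomorphic_polynomial_add holomorphic_polynomial_mult holomorphic_polynomial_const) auto
    with x have "norm (q x) \<le> (SUP y\<in>graph_over K F. norm (q y))"
      unfolding polynomial_hull_def by blast
    also have "\<dots> \<le> 1 / 2"
    proof (rule cSUP_least)
      show "graph_over K F \<noteq> {}" using K by (simp add: graph_over_eq_image)
      fix y assume "y \<in> graph_over K F"
      then obtain z where z: "z \<in> K" "y = vector [z, F z]" unfolding graph_over_def by blast
      have "q y = 1 - ((z - a) * p1 y + (F z - b) * p2 y)"
        by (simp add: q_def z(2) algebra_simps)
      also have "\<dots> = ((z - a) * h1 z + (F z - b) * h2 z) - ((z - a) * p1 y + (F z - b) * p2 y)"
        by (simp only: h12[OF z(1)])
      also have "\<dots> = (z - a) * (h1 z - p1 y) + (F z - b) * (h2 z - p2 y)"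
        by (simp only: algebra_simps)
      also have "norm \<dots> \<le> M * d + N * d"
        unfolding z(2) by (intro norm_triangle_mono norm_mult_ineq[THEN order_trans] mult_mono
            M(2) N(2) z(1) less_imp_le[OF p(3)] less_imp_le[OF p(4)] less_imp_le[OF M(1)] less_imp_le[OF N(1)] norm_ge_zero)
      also have "\<dots> = (M + N) * d" by (simp only: distrib_right)
      also have "\<dots> = 1 / 2"
      proof -
        have "M + N \<noteq> 0" using M(1) N(1) by linarith
        then show ?thesis unfolding d_def by simp
      qed
      finally show "norm (q y) \<le> 1 / 2" .
    qed
    finally show False by (simp add: q_def a_def b_def)
  qed
qed

section \<open>Contractive perturbations of conjugate powers on a disc\<close>

text \<open>The conjugate contributes exactly |w - z|^2 to the real part, while the strict
  contraction S contributes more than -|w - z|^2. Continuity follows because S is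
  1-Lipschitz.\<close>

lemma strictly_monotone_disc_cnj_perturbation:
  assumes "0 < \<rho>" and S: "\<And>w z. w \<in> cball 0 \<rho> \<Longrightarrow> z \<in> cball 0 \<rho> \<Longrightarrow> w \<noteq> z \<Longrightarrow> norm (S w - S z) < norm (w - z)"
  shows "strictly_monotone_disc (\<lambda>w. cnj w + S w) \<rho>"
proof
  show "0 < \<rho>" by fact
  have "1-lipschitz_on (cball 0 \<rho>) S"
    using S by (intro lipschitz_onI) (force simp: dist_norm)+
  then show "continuous_on (cball 0 \<rho>) (\<lambda>w. cnj w + S w)"
    by (intro continuous_intros lipschitz_on_continuous_on)
  fix w z :: complex assume wz: "w \<in> cball 0 \<rho>" "z \<in> cball 0 \<rho>" "w \<noteq> z"
  have "- Re ((w - z) * (S w - S z)) \<le> norm ((w - z) * (S w - S z))"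
    using abs_Re_le_cmod[of "(w - z) * (S w - S z)"] by linarith
  also have "\<dots> < norm (w - z) * norm (w - z)"
    using S[OF wz] wz(3) by (simp add: norm_mult)
  also have "\<dots> = Re ((w - z) * cnj (w - z))"
    by (metis Re_complex_of_real complex_norm_square of_real_power power2_eq_square)
  finally show "0 < Re ((w - z) * (cnj w + S w - (cnj z + S z)))"
    by (simp add: algebra_simps)
qed

lemma power_image_cball:
  assumes "0 < r" "1 \<le> m"
  shows "(\<lambda>z::complex. z ^ m) ` cball 0 r = cball 0 (r ^ m)"
proof (intro equalityI subsetI)
  fix w :: complex assume "w \<in> cball 0 (r ^ m)"
  obtain z where z: "z ^ m = w"
  proof
    show "rcis (root m (norm w)) (Arg w / m) ^ m = w"
      using assms(2) by (simp add: DeMoivre2 rcis_cmod_Arg)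
  qed
  then have "norm z ^ m \<le> r ^ m" using \<open>w \<in> _\<close> by (auto simp flip: norm_power)
  then have "norm z \<le> r" using assms by (simp add: power_mono_iff)
  with z show "w \<in> (\<lambda>z. z ^ m) ` cball 0 r" by auto
qed (auto simp: norm_power power_mono)

(* Both R z and R zeta are the limit of R w as w^m tends to z^m through values different from z^m. *)
lemma factor_through_power:
  fixes R :: "complex \<Rightarrow> complex"
  assumes "0 < r" "1 \<le> m"
    and R: "\<And>z \<zeta>. z \<in> cball 0 r \<Longrightarrow> \<zeta> \<in> cball 0 r \<Longrightarrow> z ^ m \<noteq> \<zeta> ^ m \<Longrightarrow>
           norm (R z - R \<zeta>) < norm (z ^ m - \<zeta> ^ m)"
    and z: "z \<in> cball 0 r" "\<zeta> \<in> cball 0 r" "z ^ m = \<zeta> ^ m"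
  shows "R z = R \<zeta>"
proof (rule ccontr)
  assume "R z \<noteq> R \<zeta>"
  define e where "e = norm (R z - R \<zeta>) / 2"
  have e: "0 < e" using \<open>R z \<noteq> R \<zeta>\<close> by (simp add: e_def)
  have "z ^ m \<in> cball 0 (r ^ m)"
    using imageI[OF z(1), of "\<lambda>z. z ^ m"] unfolding power_image_cball[OF assms(1,2)] .
  \<comment> \<open>A connected set with more than one point has no isolated points, so z^m is a
    limit of other points of the disc of radius r^m, all of them m-th powers.\<close>
  moreover have "cball (0::complex) (r ^ m) \<noteq> {x}" for x
  proof
    assume "cball (0::complex) (r ^ m) = {x}"
    moreover have "0 \<in> cball (0::complex) (r ^ m)" "of_real (r ^ m) \<in> cball (0::complex) (r ^ m)"
      using assms(1) by (simp_all add: norm_power)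
    ultimately have "complex_of_real (r ^ m) = 0" by (metis singletonD)
    then show False using assms(1) by simp
  qed
  ultimately have "z ^ m islimpt cball 0 (r ^ m)"
    by (intro connected_imp_perfect convex_connected convex_cball)
  then obtain w' where w': "w' \<in> cball 0 (r ^ m)" "w' \<noteq> z ^ m" "dist w' (z ^ m) < e"
    using e unfolding islimpt_approachable by blast
  from w'(1) obtain w where "w' = w ^ m" "w \<in> cball 0 r"
    unfolding power_image_cball[OF assms(1,2), symmetric] by (rule imageE)
  with w' have w: "w \<in> cball 0 r" "w ^ m \<noteq> z ^ m" "norm (w ^ m - z ^ m) < e"
    by (simp_all add: dist_norm)
  have "norm (R w - R z) < e" "norm (R w - R \<zeta>) < e"
    using R[OF w(1) z(1)] R[OF w(1) z(2)] w z(3) by simp_all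
  then have "norm (R z - R \<zeta>) < e + e"
    using norm_triangle_ineq4[of "R w - R \<zeta>" "R w - R z"] by simp
  then show False by (simp add: e_def)
qed

text \<open>Writing F z = f (z^m) reduces the matter to a monotone f on the disc of radius r^m.
  Membership in the algebra then passes from z and F to cnj (z^m), to cnj z, and to every continuous
  function.\<close>

lemma continuous_imp_polynomially_approximable:
  assumes "0 < r" "1 \<le> m"
    and F: "\<And>z. z \<in> cball 0 r \<Longrightarrow> F z = cnj z ^ m + R z"
    and R: "\<And>z \<zeta>. z \<in> cball 0 r \<Longrightarrow> \<zeta> \<in> cball 0 r \<Longrightarrow> z ^ m \<noteq> \<zeta> ^ m \<Longrightarrow>
           norm (R z - R \<zeta>) < norm (z ^ m - \<zeta> ^ m)"
  shows "continuous_on (cball 0 r) F"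
    and "continuous_on (cball 0 r) h \<Longrightarrow> h \<in> polynomially_approximable (cball 0 r) F"
proof -
  let ?K = "cball (0::complex) r"
  \<comment> \<open>\<open>S\<close> evaluates R at an arbitrarily chosen m-th root in the disc;
    \<open>factor_through_power\<close> shows that the choice is immaterial.\<close>
  define S where "S = (\<lambda>w. R (SOME z. z \<in> ?K \<and> z ^ m = w))"
  define f where "f = (\<lambda>w. cnj w + S w)"
  have image: "(\<lambda>z. z ^ m) ` ?K = cball 0 (r ^ m)"
    by (rule power_image_cball) fact+
  have root: "(SOME z. z \<in> ?K \<and> z ^ m = w) \<in> ?K \<and> (SOME z. z \<in> ?K \<and> z ^ m = w) ^ m = w"
    if "w \<in> cball 0 (r ^ m)" for w
  proof (rule someI_ex)
    from that obtain z where "w = z ^ m" "z \<in> ?K"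
      unfolding image[symmetric] by (rule imageE)
    then show "\<exists>z. z \<in> ?K \<and> z ^ m = w" by blast
  qed
  have power_mem: "z ^ m \<in> cball 0 (r ^ m)" if "z \<in> ?K" for z
    using imageI[OF that, of "\<lambda>z. z ^ m"] unfolding image .
  have S_power: "S (z ^ m) = R z" if "z \<in> ?K" for z
    unfolding S_def
  proof (rule factor_through_power[where R = R, OF assms(1,2)])
    show "(SOME x. x \<in> ?K \<and> x ^ m = z ^ m) \<in> ?K" "(SOME x. x \<in> ?K \<and> x ^ m = z ^ m) ^ m = z ^ m"
      by (rule conjunct1[OF root[OF power_mem[OF that]]], rule conjunct2[OF root[OF power_mem[OF that]]])
    show "z \<in> ?K" by (rule that)
  qed (rule R)
  have f: "strictly_monotone_disc f (r ^ m)"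
    unfolding f_def
  proof (rule strictly_monotone_disc_cnj_perturbation)
    show "norm (S w - S z) < norm (w - z)"
      if "w \<in> cball 0 (r ^ m)" "z \<in> cball 0 (r ^ m)" "w \<noteq> z" for w z
      using R[of "SOME x. x \<in> ?K \<and> x ^ m = w" "SOME x. x \<in> ?K \<and> x ^ m = z"] root[OF that(1)] root[OF that(2)] that(3)
      by (simp add: S_def)
  qed (use assms(1) in simp)
  then interpret strictly_monotone_disc f "r ^ m" .
  have f_power: "F z = f (z ^ m)" if "z \<in> ?K" for z
    using F[OF that] S_power[OF that] by (simp add: f_def)
  have "continuous_on ?K (\<lambda>z. f (z ^ m))"
    by (rule continuous_on_compose2[OF continuous])
       (simp_all only: continuous_on_power continuous_on_id image order.refl)
  then show contF: "continuous_on ?K F"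
    by (rule continuous_on_eq) (rule f_power[symmetric])
  have alg: "uniformly_closed_algebra ?K (polynomially_approximable ?K F)"
    by (intro uniformly_closed_algebra_polynomially_approximable contF compact_cball)
  then interpret uniformly_closed_algebra ?K "polynomially_approximable ?K F" .
  have "(\<lambda>z. cnj (z ^ m)) \<in> polynomially_approximable ?K F"
  proof (rule cnj_member[OF f])
    show "(\<lambda>z. f (z ^ m)) \<in> polynomially_approximable ?K F"
      by (rule cong[OF second_polynomially_approximable f_power])
    show "(\<lambda>z. z ^ m) \<in> polynomially_approximable ?K F"
      by (rule power[OF id_polynomially_approximable])
  qed (simp only: image order.refl)
  then have "(\<lambda>z. cnj z ^ m) \<in> polynomially_approximable ?K F" by simp
  then have "(\<lambda>z. cnj z) \<in> polynomially_approximable ?K F"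
    by (rule cnj_member_of_cnj_power[OF alg id_polynomially_approximable _ assms(2)])
  then show "h \<in> polynomially_approximable ?K F" if "continuous_on ?K h"
    by (rule continuous_imp_member[OF alg id_polynomially_approximable _ that])
qed

theorem theorem1p9:
  fixes r :: real and m :: nat and R F :: "complex \<Rightarrow> complex"
  assumes "r > 0" and "m \<ge> 1"
    and "\<And>z. z \<in> cball 0 r \<Longrightarrow> F z = cnj z ^ m + R z"
    and "\<And>z \<zeta>. z \<in> cball 0 r \<Longrightarrow> \<zeta> \<in> cball 0 r \<Longrightarrow> z ^ m \<noteq> \<zeta> ^ m \<Longrightarrow>
           norm (R z - R \<zeta>) < norm (z ^ m - \<zeta> ^ m)"
  shows "polynomially_convex (graph_over (cball 0 r) F)
    \<and> (m = 1 \<longrightarrow>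
         uniform_algebra (cball 0 r) (\<lambda>z. z) F = mspace (C_space (cball 0 r)))
    \<and> (m \<ge> 2 \<and> C1_up_to_boundary (cball 0 r) R
         \<and> (\<exists>\<alpha>. 0 < \<alpha> \<and> \<alpha> < 1 \<and>
              (\<forall>z \<in> cball 0 r. \<forall>\<zeta> \<in> cball 0 r. z ^ m \<noteq> \<zeta> ^ m \<longrightarrow>
                 norm (R z - R \<zeta>) < \<alpha> * norm (z ^ m - \<zeta> ^ m)))
        \<longrightarrow> uniform_algebra (cball 0 r) (\<lambda>z. z) F = mspace (C_space (cball 0 r)))"
proof -
  \<comment> \<open>Continuity of F and density of the polynomials in z and F feed both the
    convexity and the algebra statement.\<close>
  note F = continuous_imp_polynomially_approximable[OF assms]
  have "polynomially_convex (graph_over (cball 0 r) F)"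
    using assms(1) by (intro polynomially_convex_graph F compact_cball) auto
  moreover have "uniform_algebra (cball 0 r) (\<lambda>z. z) F = mspace (C_space (cball 0 r))"
    by (intro uniform_algebra_eq_C_space F compact_cball)
  ultimately show ?thesis by blast
qed

end
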